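(* There is an absolute constant $C>0$ such that the following holds. Let $\xi_1,\dots,\xi_n\in\{0,1\}$ be random variables with joint distribution $\mu$ which is $k$-homogeneous and (one-sided) $\ell_\infty$-independent with parameter $D$. Let $\mathbf{Y}_1,\dots,\mathbf{Y}_n\in\mathbb{R}^{d\times d}$ be symmetric matrices with $0\preceq \mathbf{Y}_i\preceq R\,\mathbf{I}$ for all $i\in[n]$, for some $R>0$. Define $\mu_{\min}:=\lambda_{\min}\big(\mathbb{E}_{\xi\sim\mu}[\sum_i \xi_i\mathbf{Y}_i]\big)$ and $\mu_{\max}:=\lambda_{\max}\big(\mathbb{E}_{\xi\sim\mu}[\sum_i \xi_i\mathbf{Y}_i]\big)$. Then for every $\delta\in[0,1]$, \[ \Pr\Big[\lambda_{\min}\Big(\sum_i \xi_i\mathbf{Y}_i\Big)\le(1-\delta)\mu_{\min}\Big]\le d\exp\Big(-\frac{\delta^2\mu_{\min}}{C R D^2}\Big) \] and \[ \Pr\Big[\lambda_{\max}\Big(\sum_i \xi_i\mathbf{Y}_i\Big)\ge(1+\delta)\mu_{\max}\Big]\le d\exp\Big(-\frac{\delta^2\mu_{\max}}{C R D^2}\Big). \]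
   Context: A distribution $\mu$ on $\{0,1\}^n$ is $k$-homogeneous if every outcome $\xi\sim\mu$ satisfies $\|\xi\|_1=k$ with probability $1$. For $\Lambda\subset[n]$ and $i,j\in[n]\setminus\Lambda$, the one-sided influence of $i$ on $j$ under $\Lambda$ is $\mathcal{I}^\Lambda_\mu(i\to j):=\Pr_{\xi\sim\mu}[\xi_j=1\mid \xi_i=1,\ \xi_\ell=1\ \forall \ell\in\Lambda]-\Pr_{\xi\sim\mu}[\xi_j=1\mid \xi_\ell=1\ \forall\ell\in\Lambda]$; the one-sided influence matrix has entries $\mathcal{I}^\Lambda_\mu(i,j):=\mathcal{I}^\Lambda_\mu(i\to j)$ if the event $\{\xi_\ell=1\ \forall \ell\in\Lambda\cup\{i,j\}\}$ has positive probability, and $0$ otherwise. $\mu$ is (one-sided) $\ell_\infty$-independent with parameter $D$ if $\|\mathcal{I}^\Lambda_\mu\|_\infty=\max_i\sum_j|\mathcal{I}^\Lambda_\mu(i,j)|\le D$ for all $\Lambda\subset[n]$. $\lambda_{\min},\lambda_{\max}$ denote the smallest and largest eigenvalues; $\preceq$ is the Loewner order. *)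

theory Defs
  imports
    "HOL-Probability.Probability"
    "Jordan_Normal_Form.Spectral_Radius"
begin

text \<open>Dimensions are explicit natural numbers (matrices are those of Jordan_Normal_Form) rather
  than types, since the dimensions have to be quantified inside the scope of an absolute constant.\<close>

text \<open>The values are real so that a coordinate can be used directly as a coefficient.\<close>

definition cube :: "nat \<Rightarrow> (nat \<Rightarrow> real) set" where
  "cube n = {1..n} \<rightarrow>\<^sub>E {0, 1}"

definition distribution_on_cube :: "nat \<Rightarrow> (nat \<Rightarrow> real) pmf \<Rightarrow> bool" where
  "distribution_on_cube n \<mu> \<longleftrightarrow> set_pmf \<mu> \<subseteq> cube n"

definition homogeneous :: "nat \<Rightarrow> nat \<Rightarrow> (nat \<Rightarrow> real) pmf \<Rightarrow> bool" where
  "homogeneous n k \<mu> \<longleftrightarrow> (AE \<xi> in measure_pmf \<mu>. (\<Sum>i = 1..n. \<bar>\<xi> i\<bar>) = real k)"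

definition one_sided_influence ::
  "(nat \<Rightarrow> real) pmf \<Rightarrow> nat set \<Rightarrow> nat \<Rightarrow> nat \<Rightarrow> real" where
  "one_sided_influence \<mu> \<Lambda> i j =
     \<P>(\<xi> in measure_pmf \<mu>. \<xi> j = 1 \<bar> \<xi> i = 1 \<and> (\<forall>l\<in>\<Lambda>. \<xi> l = 1))
   - \<P>(\<xi> in measure_pmf \<mu>. \<xi> j = 1 \<bar> (\<forall>l\<in>\<Lambda>. \<xi> l = 1))"

text \<open>The matrix is indexed by \<open>{1..n} - \<Lambda>\<close>; entries outside this index set are never used.\<close>

definition influence_matrix ::
  "(nat \<Rightarrow> real) pmf \<Rightarrow> nat set \<Rightarrow> nat \<Rightarrow> nat \<Rightarrow> real" where
  "influence_matrix \<mu> \<Lambda> i j =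
     (if \<P>(\<xi> in measure_pmf \<mu>. \<forall>l\<in>\<Lambda> \<union> {i, j}. \<xi> l = 1) > 0
      then one_sided_influence \<mu> \<Lambda> i j else 0)"

text \<open>The empty matrix has norm 0.\<close>

definition infty_norm :: "nat set \<Rightarrow> (nat \<Rightarrow> nat \<Rightarrow> real) \<Rightarrow> real" where
  "infty_norm S A = (if S = {} then 0 else MAX i\<in>S. \<Sum>j\<in>S. \<bar>A i j\<bar>)"

definition linf_independent :: "nat \<Rightarrow> (nat \<Rightarrow> real) pmf \<Rightarrow> real \<Rightarrow> bool" where
  "linf_independent n \<mu> D \<longleftrightarrow>
     (\<forall>\<Lambda> \<subseteq> {1..n}. infty_norm ({1..n} - \<Lambda>) (influence_matrix \<mu> \<Lambda>) \<le> D)"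

definition symmetric_real_mat :: "nat \<Rightarrow> real mat \<Rightarrow> bool" where
  "symmetric_real_mat d A \<longleftrightarrow> A \<in> carrier_mat d d \<and> transpose_mat A = A"

definition psd_mat :: "nat \<Rightarrow> real mat \<Rightarrow> bool" where
  "psd_mat d A \<longleftrightarrow> symmetric_real_mat d A \<and>
     (\<forall>v \<in> carrier_vec d. scalar_prod v (A *\<^sub>v v) \<ge> 0)"

definition loewner_le :: "nat \<Rightarrow> real mat \<Rightarrow> real mat \<Rightarrow> bool" where
  "loewner_le d A B \<longleftrightarrow> symmetric_real_mat d A \<and> symmetric_real_mat d B \<and> psd_mat d (B - A)"

text \<open>Meaningful for symmetric matrices of dimension at least 1, whose spectrum over the reals is
  finite and nonempty.\<close>

definition lambda_min :: "real mat \<Rightarrow> real" where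
  "lambda_min A = Min (spectrum A)"

definition lambda_max :: "real mat \<Rightarrow> real" where
  "lambda_max A = Max (spectrum A)"

definition mat_sum :: "nat \<Rightarrow> ('i \<Rightarrow> real mat) \<Rightarrow> 'i set \<Rightarrow> real mat" where
  "mat_sum d F I = Matrix.mat d d (\<lambda>(a, b). \<Sum>i\<in>I. F i $$ (a, b))"

definition mat_expectation :: "nat \<Rightarrow> 'a pmf \<Rightarrow> ('a \<Rightarrow> real mat) \<Rightarrow> real mat" where
  "mat_expectation d \<mu> F =
     Matrix.mat d d (\<lambda>(a, b). measure_pmf.expectation \<mu> (\<lambda>\<xi>. F \<xi> $$ (a, b)))"

definition random_mat_sum :: "nat \<Rightarrow> nat \<Rightarrow> (nat \<Rightarrow> real mat) \<Rightarrow> (nat \<Rightarrow> real) \<Rightarrow> real mat" where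
  "random_mat_sum n d Y \<xi> = mat_sum d (\<lambda>i. \<xi> i \<cdot>\<^sub>m Y i) {1..n}"

end

theory Submission
  imports Defs
begin

text \<open>Reveal the set of ones of \<open>\<xi>\<close> in uniformly random order. If \<open>Z\<close> is the conditional mean of the
  unrevealed part and \<open>m\<close> elements remain, the next element changes the total conditional mean by a
  matrix \<open>M\<close> whose coefficients are the influences, with \<open>E M = 0\<close> and
  \<open>E M\<^sup>2 \<le> 4 D\<^sup>2 R Z / m\<close>, while it moves an expected amount \<open>Z / m\<close> to the revealed part. So if the
  unrevealed part is weighted by \<open>\<phi>\<close> and the revealed part by \<open>\<phi> - g\<close> with \<open>g\<close> of order \<open>\<phi>\<^sup>2 D\<^sup>2 R\<close>,
  the drift \<open>- g Z / m\<close> pays for the variance at every step, without any loss from summing over the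
  steps. The trace exponential of the weighted sum is then a supermartingale, and Markov's
  inequality gives both tails.

  Neither Lieb's theorem nor the Golden--Thompson inequality is needed: for \<open>X\<close> of norm at most 1,
  \<open>tr exp (B + X) \<le> tr ((I + X + 2 X\<^sup>2) exp B)\<close> follows from scalar inequalities by expanding in
  the eigenbases of \<open>B\<close> and of \<open>B + X\<close> simultaneously.

  The argument needs \<open>D\<close> bounded below; for \<open>D < 1/2\<close> the distribution is deterministic.\<close>

section \<open>Vectors and the spectral theorem\<close>

text \<open>The bound on \<open>E M^2\<close> averages over the revealed element, that is, down the
  columns of the influence matrix, whereas the hypothesis bounds rows. An influence multiplied by
  the weight of its row is a covariance, and covariances are symmetric: the row bound becomes a
  column bound weighted by marginals, and these weights reassemble \<open>Z / m\<close>. Homogeneity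
  makes the number \<open>m\<close> of remaining elements deterministic and the rows of covariances
  sum to zero, hence \<open>E M = 0\<close>; the same zero sums control the entries that the
  influence matrix replaces by 0, at the price of \<open>2 D\<close> in place of \<open>D\<close>,
  which is squared to the factor 4. The random order is not built as a probability space: sums over
  pairs of a set and one of its elements outside \<open>L\<close> play its role. At scale
  \<open>\<theta>\<close>, a relative deviation \<open>\<delta>\<close> gains
  \<open>\<theta> \<delta>\<close> per unit of mean and \<open>g\<close> costs order
  \<open>\<theta>^2 D^2 R\<close>. Balancing the two puts \<open>\<theta>\<close> at order
  \<open>\<delta> / (D^2 R)\<close> and yields the exponent.\<close>

text \<open>Vectors and matrices are functions on the naturals of which only the indices below \<open>d\<close> matter,
  so that sums of matrices are pointwise and the product topology provides compactness.\<close>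

definition ip :: "nat \<Rightarrow> (nat \<Rightarrow> real) \<Rightarrow> (nat \<Rightarrow> real) \<Rightarrow> real" where
  "ip d x y = (\<Sum>a<d. x a * y a)"

definition mv :: "nat \<Rightarrow> (nat \<Rightarrow> nat \<Rightarrow> real) \<Rightarrow> (nat \<Rightarrow> real) \<Rightarrow> nat \<Rightarrow> real" where
  "mv d A x = (\<lambda>a. \<Sum>b<d. A a b * x b)"

definition symmetric_below :: "nat \<Rightarrow> (nat \<Rightarrow> nat \<Rightarrow> real) \<Rightarrow> bool" where
  "symmetric_below d A \<longleftrightarrow> (\<forall>a<d. \<forall>b<d. A a b = A b a)"

definition orthonormal :: "nat \<Rightarrow> nat \<Rightarrow> (nat \<Rightarrow> nat \<Rightarrow> real) \<Rightarrow> bool" where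
  "orthonormal d m U \<longleftrightarrow> (\<forall>i<m. \<forall>j<m. ip d (U i) (U j) = (if i = j then 1 else 0))"

definition eigensystem ::
  "nat \<Rightarrow> nat \<Rightarrow> (nat \<Rightarrow> nat \<Rightarrow> real) \<Rightarrow> (nat \<Rightarrow> real) \<Rightarrow> (nat \<Rightarrow> nat \<Rightarrow> real) \<Rightarrow> bool" where
  "eigensystem d m A b U \<longleftrightarrow>
     orthonormal d m U \<and> (\<forall>j<m. \<forall>a<d. mv d A (U j) a = b j * U j a)"

lemma ip_commute: "ip d x y = ip d y x"
  by (simp add: ip_def mult.commute)

lemma ip_add_left: "ip d (\<lambda>a. x a + y a) z = ip d x z + ip d y z"
  and ip_add_right: "ip d z (\<lambda>a. x a + y a) = ip d z x + ip d z y"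
  and ip_diff_left: "ip d (\<lambda>a. x a - y a) z = ip d x z - ip d y z"
  and ip_diff_right: "ip d z (\<lambda>a. x a - y a) = ip d z x - ip d z y"
  and ip_scale_left: "ip d (\<lambda>a. c * x a) z = c * ip d x z"
  and ip_scale_right: "ip d z (\<lambda>a. c * x a) = c * ip d z x"
  by (simp_all add: ip_def algebra_simps sum.distrib sum_subtractf sum_distrib_left)

lemma ip_sum_left: "ip d (\<lambda>a. \<Sum>j\<in>J. f j a) z = (\<Sum>j\<in>J. ip d (f j) z)"
  unfolding ip_def by (simp add: sum_distrib_right sum.swap[of _ J])

lemma ip_sum_right: "ip d z (\<lambda>a. \<Sum>j\<in>J. f j a) = (\<Sum>j\<in>J. ip d z (f j))"
  using ip_sum_left[of d f J z] by (simp add: ip_commute)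

lemmas ip_linear = ip_add_left ip_add_right ip_diff_left ip_diff_right ip_scale_left
  ip_scale_right ip_sum_left ip_sum_right

lemma ip_self_nonneg [simp]: "ip d x x \<ge> 0"
  by (simp add: ip_def sum_nonneg)

lemma ip_cong:
  "(\<And>a. a < d \<Longrightarrow> x a = x' a) \<Longrightarrow> (\<And>a. a < d \<Longrightarrow> y a = y' a) \<Longrightarrow> ip d x y = ip d x' y'"
  by (simp add: ip_def)

lemma ip_self_eq_0: "ip d x x = 0 \<Longrightarrow> a < d \<Longrightarrow> x a = 0"
  unfolding ip_def by (subst (asm) sum_nonneg_eq_0_iff) auto

lemma ip_mv: "symmetric_below d A \<Longrightarrow> ip d x (mv d A y) = ip d (mv d A x) y"
  unfolding ip_def mv_def symmetric_below_def
  by (simp add: sum_distrib_left sum_distrib_right mult_ac)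
     (subst sum.swap, auto intro!: sum.cong)

lemma mv_cong: "(\<And>a. a < d \<Longrightarrow> x a = y a) \<Longrightarrow> mv d A x = mv d A y"
  by (simp add: mv_def)

lemma mv_vec_linear:
  "mv d A (\<lambda>a. x a + y a) = (\<lambda>a. mv d A x a + mv d A y a)"
  "mv d A (\<lambda>a. x a - y a) = (\<lambda>a. mv d A x a - mv d A y a)"
  "mv d A (\<lambda>a. c * x a) = (\<lambda>a. c * mv d A x a)"
  by (simp_all add: mv_def algebra_simps sum.distrib sum_subtractf sum_distrib_left)

lemma mv_mat_linear:
  "mv d (\<lambda>a b. A a b + B a b) x = (\<lambda>a. mv d A x a + mv d B x a)"
  "mv d (\<lambda>a b. A a b - B a b) x = (\<lambda>a. mv d A x a - mv d B x a)"
  "mv d (\<lambda>a b. c * A a b) x = (\<lambda>a. c * mv d A x a)"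
  by (simp_all add: mv_def algebra_simps sum.distrib sum_subtractf sum_distrib_left)

lemma mv_mat_sum: "mv d (\<lambda>a b. \<Sum>j\<in>J. F j a b) x = (\<lambda>a. \<Sum>j\<in>J. mv d (F j) x a)"
  unfolding mv_def by (simp add: sum_distrib_right sum.swap[of _ J])

lemma ip_indicator: "c < d \<Longrightarrow> ip d (\<lambda>a. if a = c then 1 else 0) x = x c"
proof -
  assume "c < d"
  hence "(\<Sum>a<d. if a = c then x a else 0) = x c" by simp
  moreover have "ip d (\<lambda>a. if a = c then 1 else 0) x = (\<Sum>a<d. if a = c then x a else 0)"
    unfolding ip_def by (intro sum.cong) auto
  ultimately show ?thesis by simp
qed

text \<open>For orthonormal \<open>U\<close> this is the projection of the \<open>c\<close>-th
  standard basis vector onto the orthogonal complement of the first \<open>m\<close>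
  vectors.\<close>

definition residual :: "nat \<Rightarrow> (nat \<Rightarrow> nat \<Rightarrow> real) \<Rightarrow> nat \<Rightarrow> nat \<Rightarrow> real" where
  "residual m U c = (\<lambda>a. (if a = c then 1 else 0) - (\<Sum>j<m. U j c * U j a))"

lemma residual_orthogonal:
  assumes "orthonormal d m U" "c < d" "i < m"
  shows "ip d (residual m U c) (U i) = 0"
proof -
  have "ip d (residual m U c) (U i) = U i c - (\<Sum>j<m. U j c * ip d (U j) (U i))"
    unfolding residual_def using assms by (simp add: ip_linear ip_indicator)
  also have "(\<Sum>j<m. U j c * ip d (U j) (U i)) = (\<Sum>j<m. if j = i then U i c else 0)"
    using assms by (intro sum.cong) (auto simp: orthonormal_def)
  finally show ?thesis using assms by simp
qed

lemma residual_norm: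
  assumes "orthonormal d m U" "c < d"
  shows "ip d (residual m U c) (residual m U c) = 1 - (\<Sum>j<m. (U j c)\<^sup>2)"
proof -
  have "ip d (residual m U c) (residual m U c) =
    ip d (\<lambda>a. if a = c then 1 else 0) (residual m U c) - (\<Sum>j<m. U j c * ip d (U j) (residual m U c))"
    by (subst residual_def, simp add: ip_linear)
  also have "(\<Sum>j<m. U j c * ip d (U j) (residual m U c)) = 0"
    using residual_orthogonal[OF assms] by (auto intro!: sum.neutral simp: ip_commute)
  finally show ?thesis using assms
    by (simp add: ip_indicator) (simp add: residual_def power2_eq_square)
qed

text \<open>The sum is the trace of the projection onto the orthogonal complement. It replaces a
  dimension count: being zero for \<open>m = d\<close> it yields completeness, and being positive
  for \<open>m < d\<close> it yields a further orthogonal unit vector.\<close>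

lemma sum_residual_norm:
  assumes "orthonormal d m U"
  shows "(\<Sum>c<d. ip d (residual m U c) (residual m U c)) = real d - real m"
proof -
  have "(\<Sum>c<d. \<Sum>j<m. (U j c)\<^sup>2) = (\<Sum>j<m. ip d (U j) (U j))"
    by (subst sum.swap) (simp add: ip_def power2_eq_square)
  also have "\<dots> = real m" using assms by (simp add: orthonormal_def)
  finally show ?thesis using assms by (simp add: residual_norm sum_subtractf)
qed

lemma completeness:
  assumes "orthonormal d d U" "a < d" "c < d"
  shows "(\<Sum>j<d. U j c * U j a) = (if a = c then 1 else 0)"
proof -
  have "(\<Sum>c<d. ip d (residual d U c) (residual d U c)) = 0"
    using sum_residual_norm[OF assms(1)] by simp
  hence "ip d (residual d U c) (residual d U c) = 0"
    using assms by (subst (asm) sum_nonneg_eq_0_iff) auto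
  hence "residual d U c a = 0" using ip_self_eq_0 assms by blast
  thus ?thesis by (simp add: residual_def)
qed

lemma parseval:
  assumes "orthonormal d d U"
  shows "(\<Sum>j<d. ip d (U j) x * ip d (U j) y) = ip d x y"
proof -
  have "(\<Sum>j<d. ip d (U j) x * ip d (U j) y) = (\<Sum>j<d. \<Sum>a<d. \<Sum>c<d. x a * y c * (U j c * U j a))"
    unfolding ip_def by (simp add: sum_product mult_ac)
  also have "\<dots> = (\<Sum>a<d. \<Sum>c<d. \<Sum>j<d. x a * y c * (U j c * U j a))"
    by (subst sum.swap) (intro sum.cong refl sum.swap)
  also have "\<dots> = (\<Sum>a<d. \<Sum>c<d. if a = c then x a * y a else 0)"
    by (intro sum.cong refl, subst sum_distrib_left[symmetric])
       (simp add: completeness[OF assms])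
  also have "\<dots> = ip d x y" by (simp add: ip_def)
  finally show ?thesis .
qed

lemma exists_orthogonal_unit:
  assumes "orthonormal d m U" "m < d"
  shows "\<exists>x. (\<forall>a\<ge>d. x a = 0) \<and> ip d x x = 1 \<and> (\<forall>j<m. ip d (U j) x = 0)"
proof -
  have "(\<Sum>c<d. ip d (residual m U c) (residual m U c)) > 0"
    using sum_residual_norm[OF assms(1)] assms(2) by simp
  then obtain c where c: "c < d" "ip d (residual m U c) (residual m U c) > 0"
    by (metis (no_types, lifting) lessThan_iff not_less sum_nonpos)
  define r where "r = residual m U c"
  define s where "s = sqrt (ip d r r)"
  have s: "s > 0" "s * s = ip d r r" using c by (auto simp: s_def r_def)
  define t where "t = 1 / s"
  define x where "x = (\<lambda>a. if a < d then t * r a else 0)"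
  have eq: "ip d x y = t * ip d r y" for y
    using ip_cong[of d x "\<lambda>a. t * r a" y y] by (simp add: x_def ip_linear)
  have "ip d x x = t * (t * ip d r r)" using eq[of x] eq[of r] by (simp add: ip_commute)
  hence "ip d x x = 1" using s(1) by (simp add: t_def s(2)[symmetric])
  moreover have "ip d (U j) x = 0" if "j < m" for j
    using eq[of "U j"] residual_orthogonal[OF assms(1) c(1) that] by (simp add: ip_commute r_def)
  ultimately show ?thesis by (intro exI[of _ x]) (auto simp: x_def)
qed

section \<open>Eigenvectors by maximising the quadratic form\<close>

lemma linear_le_quadratic_imp_zero:
  fixes p q :: real
  assumes "\<And>t. 2 * t * p + t\<^sup>2 * q \<ge> 0"
  shows "p = 0"
proof (rule ccontr)
  assume p: "p \<noteq> 0"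
  \<comment> \<open>The minimiser would be \<open>- p / q\<close>; the larger, positive
    \<open>r\<close> in place of \<open>q\<close> avoids a case split on the sign of
    \<open>q\<close>.\<close>
  define r where "r = \<bar>q\<bar> + 1"
  have r: "r > 0" "q < r" unfolding r_def by auto
  have "2 * (- p / r) * p + (- p / r)\<^sup>2 * q = (p\<^sup>2 / r) * (q / r - 2)"
    using r by (simp add: field_simps power2_eq_square)
  moreover have "p\<^sup>2 / r > 0" "q / r - 2 < 0" using p r by (auto simp: field_simps)
  ultimately show False using assms[of "- p / r"] by (metis mult_pos_neg not_le)
qed

lemma continuous_on_coordinate [continuous_intros]:
  "continuous_on S (\<lambda>x :: nat \<Rightarrow> real. x a)"
  by (rule continuous_on_subset[OF continuous_on_product_coordinates]) auto

text \<open>Coordinates from \<open>d\<close> on are pinned to 0, as they would otherwise range over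
  all reals; what remains is a closed part of a product of compact intervals.\<close>

lemma compact_unit_sphere_orthogonal:
  "compact {x. (\<forall>a\<ge>d. x a = 0) \<and> ip d x x = 1 \<and> (\<forall>j<m. ip d (U j) x = 0)}" (is "compact ?K")
proof -
  define S where "S = (\<lambda>a. if a < d then {-1..1} else {0::real})"
  have "compactin (product_topology (\<lambda>_. euclidean) UNIV) (PiE UNIV S)"
    by (auto simp: compactin_PiE S_def)
  hence "compact (PiE UNIV S)" by (simp add: euclidean_product_topology)
  moreover have "closed {x. ip d x x = 1 \<and> (\<forall>j<m. ip d (U j) x = 0)}"
    unfolding ip_def
    by (intro closed_Collect_conj closed_Collect_all closed_Collect_imp closed_Collect_eq
        continuous_intros) auto
  moreover have "?K = PiE UNIV S \<inter> {x. ip d x x = 1 \<and> (\<forall>j<m. ip d (U j) x = 0)}"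
  proof -
    have "x \<in> PiE UNIV S" if "\<forall>a\<ge>d. x a = 0" "ip d x x = 1" for x
    proof -
      have "\<bar>x a\<bar> \<le> 1" if "a < d" for a
      proof -
        have "x a * x a \<le> ip d x x"
          unfolding ip_def using that by (intro member_le_sum) auto
        hence "(x a)\<^sup>2 \<le> 1" using \<open>ip d x x = 1\<close> by (simp add: power2_eq_square)
        thus ?thesis by (simp add: abs_square_le_1)
      qed
      thus ?thesis using that by (auto simp: S_def abs_le_iff)
    qed
    moreover have "x a = 0" if "x \<in> PiE UNIV S" "a \<ge> d" for x a
      using that by (auto simp: S_def PiE_iff split: if_splits dest!: spec[of _ a])
    ultimately show ?thesis by blast
  qed
  ultimately show ?thesis by (simp add: compact_Int_closed)
qed

text \<open>The new eigenvector \<open>v\<close> maximises the quadratic form over the unit vectors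
  orthogonal to the old ones. Symmetry keeps the defect \<open>w = l v - A v\<close> orthogonal to
  them too, so \<open>v + t w\<close> is an admissible variation for every \<open>t\<close>, and
  first-order optimality forces \<open>w\<close> to vanish.\<close>

lemma eigensystem_extend:
  assumes A: "symmetric_below d A" and E: "eigensystem d m A b U" and m: "m < d"
  shows "\<exists>b U. eigensystem d (Suc m) A b U"
proof -
  have on: "orthonormal d m U" using E by (simp add: eigensystem_def)
  define K where "K = {x. (\<forall>a\<ge>d. x a = 0) \<and> ip d x x = 1 \<and> (\<forall>j<m. ip d (U j) x = 0)}"
  have "compact K" unfolding K_def by (rule compact_unit_sphere_orthogonal)
  moreover have "K \<noteq> {}" using exists_orthogonal_unit[OF on m] by (auto simp: K_def)
  moreover have "continuous_on K (\<lambda>x. ip d x (mv d A x))"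
    unfolding ip_def mv_def by (intro continuous_intros)
  ultimately obtain v where v: "v \<in> K" "\<And>y. y \<in> K \<Longrightarrow> ip d y (mv d A y) \<le> ip d v (mv d A v)"
    using continuous_attains_sup[of K "\<lambda>x. ip d x (mv d A x)"] by blast
  define l where "l = ip d v (mv d A v)"
  have v1: "ip d v v = 1" and vU: "\<And>j. j < m \<Longrightarrow> ip d (U j) v = 0" using v by (auto simp: K_def)
  have bound: "ip d y (mv d A y) \<le> l * ip d y y" if y: "\<forall>j<m. ip d (U j) y = 0" for y
  proof (cases "ip d y y = 0")
    case True
    hence "ip d y (mv d A y) = ip d (\<lambda>_. 0) (mv d A y)"
      by (intro ip_cong) (auto dest: ip_self_eq_0)
    thus ?thesis using True by (simp add: ip_def)
  next
    case False
    define s where "s = sqrt (ip d y y)"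
    have s: "s > 0" "s * s = ip d y y"
      using False ip_self_nonneg[of d y] by (auto simp: s_def simp del: ip_self_nonneg)
    define t where "t = 1 / s"
    define z where "z = (\<lambda>a. if a < d then t * y a else 0)"
    have eq: "ip d z u = t * ip d y u" for u
      using ip_cong[of d z "\<lambda>a. t * y a" u u] by (simp add: z_def ip_linear)
    have eqA: "mv d A z = (\<lambda>a. t * mv d A y a)"
      using mv_cong[of d z "\<lambda>a. t * y a" A] by (simp add: z_def mv_vec_linear)
    have "ip d z z = t * (t * ip d y y)" using eq[of z] eq[of y] by (simp add: ip_commute)
    hence "ip d z z = 1" using s(1) by (simp add: t_def s(2)[symmetric])
    moreover have "ip d (U j) z = 0" if "j < m" for j
      using y that eq[of "U j"] by (simp add: ip_commute)
    ultimately have "z \<in> K" by (auto simp: K_def z_def)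
    hence "ip d z (mv d A z) \<le> l" using v by (simp add: l_def)
    hence "t * (t * ip d y (mv d A y)) \<le> l" by (simp add: eq eqA ip_scale_right)
    hence "t * (t * ip d y (mv d A y)) * ip d y y \<le> l * ip d y y" by (rule mult_right_mono) simp
    moreover have "t * t * ip d y y = 1" using s(1) by (simp add: t_def s(2)[symmetric])
    hence "t * (t * ip d y (mv d A y)) * ip d y y = ip d y (mv d A y)"
      by (metis mult.assoc mult.commute mult_1)
    ultimately show ?thesis by simp
  qed
  define w where "w = (\<lambda>a. l * v a - mv d A v a)"
  have wU: "ip d (U j) w = 0" if j: "j < m" for j
  proof -
    have "ip d (U j) (mv d A v) = ip d (\<lambda>a. b j * U j a) v"
      using E j by (subst ip_mv[OF A], intro ip_cong) (auto simp: eigensystem_def)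
    thus ?thesis using vU[OF j] by (simp add: w_def ip_linear)
  qed
  have "2 * t * ip d w w + t\<^sup>2 * (l * ip d w w - ip d w (mv d A w)) \<ge> 0" for t
  proof -
    have vw: "ip d v (mv d A w) = ip d w (mv d A v)"
      by (subst ip_mv[OF A]) (simp add: ip_commute)
    have "ip d (\<lambda>a. v a + t * w a) (mv d A (\<lambda>a. v a + t * w a))
        \<le> l * ip d (\<lambda>a. v a + t * w a) (\<lambda>a. v a + t * w a)"
      using vU wU by (intro bound) (simp add: ip_linear)
    hence "l + 2 * t * ip d w (mv d A v) + t\<^sup>2 * ip d w (mv d A w)
        \<le> l * (1 + 2 * t * ip d w v + t\<^sup>2 * ip d w w)"
      using vw v1 ip_commute[of d v w]
      by (simp add: mv_vec_linear ip_linear l_def[symmetric] power2_eq_square algebra_simps)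
    moreover have "ip d w w = l * ip d w v - ip d w (mv d A v)"
      by (subst (2) w_def) (simp add: ip_linear)
    then have "l * ip d w v = ip d w w + ip d w (mv d A v)" by simp
    moreover have "l * (1 + 2 * t * ip d w v + t\<^sup>2 * ip d w w) =
        l + 2 * t * (l * ip d w v) + t\<^sup>2 * (l * ip d w w)"
      by (simp add: algebra_simps)
    ultimately show ?thesis by (simp only:) (simp add: algebra_simps)
  qed
  hence "ip d w w = 0" by (rule linear_le_quadratic_imp_zero)
  hence ev: "mv d A v a = l * v a" if "a < d" for a
    using ip_self_eq_0[of d w a] that by (simp add: w_def)
  have "eigensystem d (Suc m) A (b(m := l)) (U(m := v))"
    using E ev v1 vU unfolding eigensystem_def orthonormal_def
    by (auto simp: less_Suc_eq ip_commute)
  thus ?thesis by blast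
qed

theorem spectral_theorem:
  assumes "symmetric_below d A"
  obtains b U where "eigensystem d d A b U"
proof -
  have "\<exists>b U. eigensystem d m A b U" if "m \<le> d" for m
    using that
  proof (induction m)
    case 0
    show ?case by (simp add: eigensystem_def orthonormal_def)
  next
    case (Suc m)
    thus ?case using eigensystem_extend[OF assms, of m] by auto
  qed
  thus ?thesis using that by blast
qed

section \<open>The trace exponential\<close>

text \<open>The trace of \<open>exp A\<close>, read off the eigenvalues so that no matrix
  exponential is constructed. For symmetric \<open>A\<close> the choice hidden in
  \<open>SOME\<close> is immaterial by \<open>trexp_eigensystem\<close>.\<close>

definition trexp :: "nat \<Rightarrow> (nat \<Rightarrow> nat \<Rightarrow> real) \<Rightarrow> real" where
  "trexp d A = (\<Sum>j<d. exp ((SOME b. \<exists>U. eigensystem d d A b U) j))"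

lemma eigensystem_orthonormal: "eigensystem d m A b U \<Longrightarrow> orthonormal d m U"
  by (simp add: eigensystem_def)

lemma ip_mv_eigenvector:
  "eigensystem d m A b U \<Longrightarrow> j < m \<Longrightarrow> ip d x (mv d A (U j)) = b j * ip d x (U j)"
  by (subst ip_scale_right[symmetric], rule ip_cong) (auto simp: eigensystem_def)

lemma ip_eigenvector_mv:
  "symmetric_below d A \<Longrightarrow> eigensystem d m A b U \<Longrightarrow> j < m \<Longrightarrow> ip d (U j) (mv d A x) = b j * ip d (U j) x"
  by (subst ip_mv, simp, subst ip_commute) (simp add: ip_mv_eigenvector ip_commute)

lemma parseval_norm: "orthonormal d d U \<Longrightarrow> (\<Sum>j<d. (ip d (U j) x)\<^sup>2) = ip d x x"
  using parseval[of d U x x] by (simp add: power2_eq_square)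

lemma orthonormal_self: "orthonormal d m U \<Longrightarrow> j < m \<Longrightarrow> ip d (U j) (U j) = 1"
  by (simp add: orthonormal_def)

text \<open>Squared overlaps of two orthonormal bases form a doubly stochastic matrix, by Parseval
  in each basis. Sums over either spectrum become double sums with common weights, which can be
  compared term by term.\<close>

lemma sum_overlaps:
  assumes "orthonormal d d U" "orthonormal d d V"
  shows "(\<Sum>j<d. \<Sum>k<d. (ip d (U j) (V k))\<^sup>2 * f j) = (\<Sum>j<d. f j :: real)"
    and "(\<Sum>j<d. \<Sum>k<d. (ip d (U j) (V k))\<^sup>2 * g k) = (\<Sum>k<d. g k :: real)"
proof -
  have "(\<Sum>k<d. (ip d (U j) (V k))\<^sup>2) = 1" if "j < d" for j
    using parseval_norm[OF assms(2), of "U j"] orthonormal_self[OF assms(1) that]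
    by (simp add: ip_commute)
  thus "(\<Sum>j<d. \<Sum>k<d. (ip d (U j) (V k))\<^sup>2 * f j) = (\<Sum>j<d. f j)"
    by (simp add: sum_distrib_right[symmetric])
  have "(\<Sum>j<d. (ip d (U j) (V k))\<^sup>2) = 1" if "k < d" for k
    using parseval_norm[OF assms(1), of "V k"] orthonormal_self[OF assms(2) that] by simp
  thus "(\<Sum>j<d. \<Sum>k<d. (ip d (U j) (V k))\<^sup>2 * g k) = (\<Sum>k<d. g k)"
    by (subst sum.swap) (simp add: sum_distrib_right[symmetric])
qed

text \<open>Evaluating \<open>ip d (U j) (mv d A (V k))\<close> from both sides shows that only
  equal eigenvalues can have a nonzero overlap.\<close>

lemma trexp_eigensystem:
  assumes A: "symmetric_below d A" and E: "eigensystem d d A b U"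
  shows "trexp d A = (\<Sum>j<d. exp (b j))"
proof -
  define c where "c = (SOME b. \<exists>U. eigensystem d d A b U)"
  have "\<exists>V. eigensystem d d A c V" unfolding c_def by (rule someI[of _ b]) (use E in blast)
  then obtain V where F: "eigensystem d d A c V" ..
  note on = eigensystem_orthonormal[OF E] eigensystem_orthonormal[OF F]
  have "(ip d (U j) (V k))\<^sup>2 * exp (b j) = (ip d (U j) (V k))\<^sup>2 * exp (c k)" if "j < d" "k < d" for j k
    using ip_mv_eigenvector[OF F that(2), of "U j"] ip_eigenvector_mv[OF A E that(1), of "V k"]
    by auto
  hence "(\<Sum>j<d. \<Sum>k<d. (ip d (U j) (V k))\<^sup>2 * exp (b j)) =
         (\<Sum>j<d. \<Sum>k<d. (ip d (U j) (V k))\<^sup>2 * exp (c k))"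
    by (intro sum.cong refl) simp
  thus ?thesis using sum_overlaps(1)[OF on, of "\<lambda>j. exp (b j)"] sum_overlaps(2)[OF on, of "\<lambda>j. exp (c j)"]
    by (simp add: trexp_def c_def[symmetric])
qed

section \<open>Scalar bounds for exp and the perturbed trace exponential\<close>

lemma exp_diff_le: "exp c - exp b \<le> (c - b) * exp (c::real)"
proof -
  have "1 + (b - c) \<le> exp (b - c)" by (rule exp_ge_add_one_self)
  hence "(1 + (b - c)) * exp c \<le> exp (b - c) * exp c" by (rule mult_right_mono) simp
  thus ?thesis by (simp add: exp_add[symmetric] algebra_simps)
qed

lemma exp_diff_le_trapezoid_aux:
  assumes "x \<ge> (0::real)"
  shows "exp x - 1 \<le> x * (exp x + 1) / 2"
proof -
  define f where "f = (\<lambda>x::real. x * (exp x + 1) / 2 - exp x)"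
  have "f 0 \<le> f x"
  proof (rule DERIV_nonneg_imp_nondecreasing[OF assms])
    fix y :: real assume "0 \<le> y" "y \<le> x"
    have "(f has_real_derivative (1 - exp y + y * exp y) / 2) (at y)"
      unfolding f_def by (auto intro!: derivative_eq_intros simp: field_simps)
    moreover have "1 - exp y + y * exp y \<ge> 0" using exp_diff_le[of y 0] by simp
    ultimately show "\<exists>z. (f has_real_derivative z) (at y) \<and> z \<ge> 0" by force
  qed
  thus ?thesis by (simp add: f_def)
qed

text \<open>The trapezoidal rule overestimates the integral of the convex function
  \<open>exp\<close>. Its symmetry in the endpoints treats the weights \<open>exp (b j)\<close> and
  \<open>exp (c k)\<close> alike.\<close>

lemma exp_diff_le_trapezoid: "\<bar>exp c - exp b\<bar> \<le> \<bar>c - b\<bar> * ((exp c + exp (b::real)) / 2)"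
proof (induction b c rule: linorder_wlog)
  case (le b c)
  have "(exp (c - b) - 1) * exp b \<le> ((c - b) * (exp (c - b) + 1) / 2) * exp b"
    by (intro mult_right_mono exp_diff_le_trapezoid_aux) (use le in auto)
  moreover have "exp (c - b) * exp b = exp c" by (simp add: exp_add[symmetric])
  ultimately show ?case using le by (simp add: algebra_simps)
next
  case (sym b c)
  thus ?case by (simp add: abs_minus_commute add.commute)
qed

lemma symmetric_below_add: "symmetric_below d A \<Longrightarrow> symmetric_below d B \<Longrightarrow> symmetric_below d (\<lambda>a b. A a b + B a b)"
  and symmetric_below_diff: "symmetric_below d A \<Longrightarrow> symmetric_below d B \<Longrightarrow> symmetric_below d (\<lambda>a b. A a b - B a b)"
  and symmetric_below_scale: "symmetric_below d A \<Longrightarrow> symmetric_below d (\<lambda>a b. r * A a b)"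
  by (simp_all add: symmetric_below_def)

lemma symmetric_below_sum: "(\<And>j. j \<in> J \<Longrightarrow> symmetric_below d (F j)) \<Longrightarrow> symmetric_below d (\<lambda>a b. \<Sum>j\<in>J. F j a b)"
  unfolding symmetric_below_def by (auto intro!: sum.cong)

text \<open>With \<open>w\<^sub>j\<^sub>k = \<langle>U\<^sub>j, V\<^sub>k\<rangle>\<close> for eigenbases \<open>U\<close> of \<open>B\<close> and \<open>V\<close> of \<open>B + X\<close>, one has
  \<open>\<langle>U\<^sub>j, X V\<^sub>k\<rangle> = (c\<^sub>k - b\<^sub>j) w\<^sub>j\<^sub>k\<close>. Convexity and the trapezoid bound for \<open>exp\<close> leave
  \<open>h\<^sub>1 = tr (X\<^sup>2 exp (B + X))\<close> to be compared with \<open>h\<^sub>0 = tr (X\<^sup>2 exp B)\<close>; the same expansion of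
  \<open>h\<^sub>1 - h\<^sub>0\<close> gives \<open>h\<^sub>1 - h\<^sub>0 \<le> (h\<^sub>0 + h\<^sub>1) / 2\<close>.\<close>

lemma trexp_perturbation:
  assumes B: "symmetric_below d B" and X: "symmetric_below d X"
    and contraction: "\<And>x. ip d (mv d X x) (mv d X x) \<le> ip d x x"
    and E: "eigensystem d d B b U"
  shows "trexp d (\<lambda>a c. B a c + X a c) \<le>
    trexp d B + (\<Sum>j<d. exp (b j) * (ip d (U j) (mv d X (U j)) + 2 * ip d (mv d X (U j)) (mv d X (U j))))"
proof -
  define C where "C = (\<lambda>a c. B a c + X a c)"
  have C: "symmetric_below d C" unfolding C_def by (intro symmetric_below_add B X)
  obtain c V where F: "eigensystem d d C c V" using spectral_theorem[OF C] .
  note onU = eigensystem_orthonormal[OF E] and onV = eigensystem_orthonormal[OF F]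
  define w where "w = (\<lambda>j k. ip d (U j) (V k))"
  define z where "z = (\<lambda>j k. ip d (V k) (mv d X (mv d X (U j))))"
  have cross: "ip d (U j) (mv d X (V k)) = (c k - b j) * w j k" if "j < d" "k < d" for j k
  proof -
    have "ip d (U j) (mv d C (V k)) = ip d (U j) (mv d B (V k)) + ip d (U j) (mv d X (V k))"
      by (simp add: C_def mv_mat_linear ip_linear)
    thus ?thesis using ip_mv_eigenvector[OF F that(2), of "U j"] ip_eigenvector_mv[OF B E that(1), of "V k"]
      by (simp add: w_def algebra_simps)
  qed
  have cross': "ip d (V k) (mv d X (U j)) = (c k - b j) * w j k" if "j < d" "k < d" for j k
    using cross[OF that] by (metis ip_mv[OF X] ip_commute)
  define h0 where "h0 = (\<Sum>j<d. exp (b j) * ip d (mv d X (U j)) (mv d X (U j)))"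
  define h1 where "h1 = (\<Sum>k<d. exp (c k) * ip d (mv d X (V k)) (mv d X (V k)))"
  have h0: "(\<Sum>j<d. \<Sum>k<d. (c k - b j)\<^sup>2 * (w j k)\<^sup>2 * exp (b j)) = h0"
    unfolding h0_def by (intro sum.cong refl, subst parseval_norm[OF onV, symmetric])
      (simp add: sum_distrib_left cross' power_mult_distrib mult_ac)
  have h1: "(\<Sum>j<d. \<Sum>k<d. (c k - b j)\<^sup>2 * (w j k)\<^sup>2 * exp (c k)) = h1"
    unfolding h1_def by (subst sum.swap, intro sum.cong refl, subst parseval_norm[OF onU, symmetric])
      (simp add: sum_distrib_left cross power_mult_distrib mult_ac)
  have lin: "(\<Sum>j<d. \<Sum>k<d. (c k - b j) * (w j k)\<^sup>2 * exp (b j)) =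
      (\<Sum>j<d. exp (b j) * ip d (U j) (mv d X (U j)))"
  proof (intro sum.cong refl)
    fix j assume j: "j \<in> {..<d}"
    have "(\<Sum>k<d. (c k - b j) * (w j k)\<^sup>2 * exp (b j)) =
        exp (b j) * (\<Sum>k<d. ip d (V k) (U j) * ip d (V k) (mv d X (U j)))"
      unfolding sum_distrib_left using j
      by (intro sum.cong refl) (simp add: cross' w_def power2_eq_square ip_commute)
    thus "(\<Sum>k<d. (c k - b j) * (w j k)\<^sup>2 * exp (b j)) = exp (b j) * ip d (U j) (mv d X (U j))"
      by (simp add: parseval[OF onV])
  qed
  have z0: "(\<Sum>j<d. \<Sum>k<d. w j k * z j k * exp (b j)) = h0"
  proof -
    have "(\<Sum>k<d. w j k * z j k * exp (b j)) = exp (b j) * ip d (mv d X (U j)) (mv d X (U j))" for j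
    proof -
      have "(\<Sum>k<d. w j k * z j k * exp (b j)) =
          exp (b j) * (\<Sum>k<d. ip d (V k) (U j) * ip d (V k) (mv d X (mv d X (U j))))"
        by (simp add: sum_distrib_left w_def z_def mult_ac ip_commute[of d "V _" "U j"])
      thus ?thesis by (simp only: parseval[OF onV]) (simp add: ip_mv[OF X])
    qed
    thus ?thesis by (simp add: h0_def)
  qed
  have z_alt: "z j k = ip d (U j) (mv d X (mv d X (V k)))" for j k
    unfolding z_def by (metis ip_mv[OF X] ip_commute)
  have z1: "(\<Sum>j<d. \<Sum>k<d. w j k * z j k * exp (c k)) = h1"
  proof -
    have "(\<Sum>j<d. w j k * z j k * exp (c k)) = exp (c k) * ip d (mv d X (V k)) (mv d X (V k))" for k
    proof -
      have "(\<Sum>j<d. w j k * z j k * exp (c k)) =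
          exp (c k) * (\<Sum>j<d. ip d (U j) (V k) * ip d (U j) (mv d X (mv d X (V k))))"
        by (simp add: sum_distrib_left w_def z_alt mult_ac)
      thus ?thesis by (simp only: parseval[OF onU]) (simp add: ip_mv[OF X])
    qed
    thus ?thesis by (subst sum.swap) (simp add: h1_def)
  qed
  \<comment> \<open>By Parseval in \<open>V\<close> the sum over \<open>k\<close> is the squared
    norm of \<open>X\<close> applied twice to \<open>U j\<close>; the contraction hypothesis removes
    one application.\<close>
  have zz0: "(\<Sum>j<d. \<Sum>k<d. (z j k)\<^sup>2 * exp (b j)) \<le> h0"
  proof -
    have "(\<Sum>k<d. (z j k)\<^sup>2 * exp (b j)) \<le> exp (b j) * ip d (mv d X (U j)) (mv d X (U j))" for j
      by (simp add: sum_distrib_right[symmetric] z_def parseval_norm[OF onV])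
        (simp add: mult.commute[of _ "exp _"] contraction)
    thus ?thesis unfolding h0_def by (intro sum_mono)
  qed
  have zz1: "(\<Sum>j<d. \<Sum>k<d. (z j k)\<^sup>2 * exp (c k)) \<le> h1"
  proof -
    have "(\<Sum>j<d. (z j k)\<^sup>2 * exp (c k)) \<le> exp (c k) * ip d (mv d X (V k)) (mv d X (V k))" for k
      by (simp add: sum_distrib_right[symmetric] z_alt parseval_norm[OF onU])
        (simp add: mult.commute[of _ "exp _"] contraction)
    thus ?thesis unfolding h1_def by (subst sum.swap) (intro sum_mono)
  qed
  have "h1 - h0 = (\<Sum>j<d. \<Sum>k<d. w j k * z j k * (exp (c k) - exp (b j)))"
    by (simp add: z0[symmetric] z1[symmetric] sum_subtractf right_diff_distrib)
  also have "\<dots> \<le> (\<Sum>j<d. \<Sum>k<d. (1/4) * ((c k - b j)\<^sup>2 * (w j k)\<^sup>2 * exp (b j)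
        + (c k - b j)\<^sup>2 * (w j k)\<^sup>2 * exp (c k) + (z j k)\<^sup>2 * exp (b j) + (z j k)\<^sup>2 * exp (c k)))"
  proof (intro sum_mono)
    fix j k
    define e where "e = exp (c k) + exp (b j)"
    have e: "e > 0" by (simp add: e_def add_pos_pos)
    have "w j k * z j k * (exp (c k) - exp (b j)) \<le> \<bar>w j k * z j k\<bar> * \<bar>exp (c k) - exp (b j)\<bar>"
      by (metis abs_ge_self abs_mult)
    also have "\<dots> \<le> \<bar>w j k * z j k\<bar> * (\<bar>c k - b j\<bar> * (e / 2))"
      unfolding e_def by (intro mult_left_mono exp_diff_le_trapezoid) auto
    also have "\<dots> = (\<bar>(c k - b j) * w j k\<bar> * \<bar>z j k\<bar>) * (e / 2)" by (simp add: abs_mult)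
    also have "\<dots> \<le> ((\<bar>(c k - b j) * w j k\<bar>\<^sup>2 + \<bar>z j k\<bar>\<^sup>2) / 2) * (e / 2)"
      using e sum_squares_bound[of "\<bar>(c k - b j) * w j k\<bar>" "\<bar>z j k\<bar>"]
      by (intro mult_right_mono) (auto simp del: power2_abs)
    also have "\<dots> = (1/4) * ((c k - b j)\<^sup>2 * (w j k)\<^sup>2 * exp (b j)
        + (c k - b j)\<^sup>2 * (w j k)\<^sup>2 * exp (c k) + (z j k)\<^sup>2 * exp (b j) + (z j k)\<^sup>2 * exp (c k))"
      unfolding power2_abs power_mult_distrib e_def by (simp add: algebra_simps add_divide_distrib)
    finally show "w j k * z j k * (exp (c k) - exp (b j)) \<le> \<dots>" .
  qed
  also have "\<dots> = (1/4) * (h0 + h1 + (\<Sum>j<d. \<Sum>k<d. (z j k)\<^sup>2 * exp (b j)) + (\<Sum>j<d. \<Sum>k<d. (z j k)\<^sup>2 * exp (c k)))"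
    unfolding sum_distrib_left[symmetric] sum.distrib by (simp add: h0 h1)
  \<comment> \<open>The total is at most \<open>(h0 + h1) / 2\<close>. Solving for \<open>h1\<close>
    gives the 3, and then \<open>(h0 + h1) / 2\<close> is at most \<open>2 * h0\<close>: the origin
    of the coefficient 2 in the statement.\<close>
  finally have h: "h1 \<le> 3 * h0" using zz0 zz1 by simp
  have "trexp d C - trexp d B = (\<Sum>j<d. \<Sum>k<d. (w j k)\<^sup>2 * exp (c k)) - (\<Sum>j<d. \<Sum>k<d. (w j k)\<^sup>2 * exp (b j))"
    unfolding w_def sum_overlaps[OF onU onV]
    by (simp add: trexp_eigensystem[OF B E] trexp_eigensystem[OF C F])
  also have "\<dots> = (\<Sum>j<d. \<Sum>k<d. (w j k)\<^sup>2 * (exp (c k) - exp (b j)))"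
    by (simp add: sum_subtractf right_diff_distrib)
  also have "\<dots> \<le> (\<Sum>j<d. \<Sum>k<d. (c k - b j) * (w j k)\<^sup>2 * exp (b j)
      + (1/2) * ((c k - b j)\<^sup>2 * (w j k)\<^sup>2 * exp (b j) + (c k - b j)\<^sup>2 * (w j k)\<^sup>2 * exp (c k)))"
  proof (intro sum_mono)
    fix j k
    define t where "t = c k - b j"
    define e where "e = exp (c k) + exp (b j)"
    \<comment> \<open>The tangent bound places the linear term at \<open>c k\<close>. It is moved to
      \<open>b j\<close>, where it sums to diagonal entries of \<open>X\<close> in the given basis
      \<open>U\<close>; the correction is of second order.\<close>
    have "exp (c k) - exp (b j) \<le> t * exp (b j) + t * (exp (c k) - exp (b j))"
      using exp_diff_le[of "c k" "b j"] by (simp add: t_def algebra_simps)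
    also have "t * (exp (c k) - exp (b j)) \<le> \<bar>t\<bar> * \<bar>exp (c k) - exp (b j)\<bar>"
      by (metis abs_ge_self abs_mult)
    also have "\<dots> \<le> \<bar>t\<bar> * (\<bar>t\<bar> * (e / 2))"
      unfolding t_def e_def by (intro mult_left_mono exp_diff_le_trapezoid) auto
    also have "\<dots> = t\<^sup>2 * (e / 2)" by (simp add: power2_eq_square)
    finally have "(w j k)\<^sup>2 * (exp (c k) - exp (b j)) \<le> (w j k)\<^sup>2 * (t * exp (b j) + t\<^sup>2 * (e / 2))"
      by (intro mult_left_mono) auto
    also have "\<dots> = t * (w j k)\<^sup>2 * exp (b j) + (1/2) * (t\<^sup>2 * (w j k)\<^sup>2 * exp (b j) + t\<^sup>2 * (w j k)\<^sup>2 * exp (c k))"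
      by (simp add: e_def algebra_simps add_divide_distrib)
    finally show "(w j k)\<^sup>2 * (exp (c k) - exp (b j)) \<le> (c k - b j) * (w j k)\<^sup>2 * exp (b j)
      + (1/2) * ((c k - b j)\<^sup>2 * (w j k)\<^sup>2 * exp (b j) + (c k - b j)\<^sup>2 * (w j k)\<^sup>2 * exp (c k))"
      by (simp only: t_def)
  qed
  also have "\<dots> = (\<Sum>j<d. exp (b j) * ip d (U j) (mv d X (U j))) + (1/2) * (h0 + h1)"
    unfolding sum.distrib sum_distrib_left[symmetric] by (simp add: h0 h1 lin)
  also have "\<dots> \<le> (\<Sum>j<d. exp (b j) * ip d (U j) (mv d X (U j))) + 2 * h0" using h by simp
  also have "\<dots> = (\<Sum>j<d. exp (b j) * (ip d (U j) (mv d X (U j)) + 2 * ip d (mv d X (U j)) (mv d X (U j))))"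
    unfolding h0_def sum_distrib_left sum.distrib[symmetric]
    by (intro sum.cong refl) (simp add: algebra_simps)
  finally show ?thesis by (simp add: C_def)
qed

text \<open>The bound of \<open>trexp_perturbation\<close> is linear in quadratic forms of
  \<open>X\<close> and \<open>X^2\<close>, evaluated in an eigenbasis of \<open>B\<close> that is
  the same for every \<open>i\<close>. So it is enough that the average of \<open>X + 2 X^2\<close>
  is negative semidefinite.\<close>

lemma trexp_average:
  assumes B: "symmetric_below d B" and X: "\<And>i. i \<in> I \<Longrightarrow> symmetric_below d (X i)"
    and contraction: "\<And>i x. i \<in> I \<Longrightarrow> ip d (mv d (X i) x) (mv d (X i) x) \<le> ip d x x"
    and q: "\<And>i. i \<in> I \<Longrightarrow> q i \<ge> 0" "(\<Sum>i\<in>I. q i) = 1"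
    and drift: "\<And>x. (\<Sum>i\<in>I. q i * (ip d x (mv d (X i) x) + 2 * ip d (mv d (X i) x) (mv d (X i) x))) \<le> 0"
  shows "(\<Sum>i\<in>I. q i * trexp d (\<lambda>a c. B a c + X i a c)) \<le> trexp d B"
proof -
  obtain b U where E: "eigensystem d d B b U" using spectral_theorem[OF B] .
  define Q where "Q = (\<lambda>i x. ip d x (mv d (X i) x) + 2 * ip d (mv d (X i) x) (mv d (X i) x))"
  have "(\<Sum>i\<in>I. q i * trexp d (\<lambda>a c. B a c + X i a c)) \<le>
      (\<Sum>i\<in>I. q i * (trexp d B + (\<Sum>j<d. exp (b j) * Q i (U j))))"
    unfolding Q_def by (intro sum_mono mult_left_mono trexp_perturbation B X contraction E q)
  also have "\<dots> = trexp d B + (\<Sum>j<d. exp (b j) * (\<Sum>i\<in>I. q i * Q i (U j)))"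
    using q(2)
    by (simp add: distrib_left sum.distrib sum_distrib_right[symmetric] sum_distrib_left)
       (subst sum.swap, simp add: mult_ac)
  also have "(\<Sum>j<d. exp (b j) * (\<Sum>i\<in>I. q i * Q i (U j))) \<le> 0"
    proof (rule sum_nonpos)
    fix j
    show "exp (b j) * (\<Sum>i\<in>I. q i * Q i (U j)) \<le> 0"
      using drift[of "U j"] by (intro mult_nonneg_nonpos) (simp_all only: Q_def exp_ge_zero)
  qed
  finally show ?thesis by simp
qed

section \<open>Quadratic forms, norms and weighted sums\<close>

abbreviation qf :: "nat \<Rightarrow> (nat \<Rightarrow> nat \<Rightarrow> real) \<Rightarrow> (nat \<Rightarrow> real) \<Rightarrow> real" where
  "qf d A x \<equiv> ip d x (mv d A x)"

abbreviation sqn :: "nat \<Rightarrow> (nat \<Rightarrow> real) \<Rightarrow> real" where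
  "sqn d x \<equiv> ip d x x"

lemma qf_eigensystem:
  assumes "symmetric_below d A" "eigensystem d d A b U"
  shows "qf d A x = (\<Sum>j<d. b j * (ip d (U j) x)\<^sup>2)"
proof -
  have "qf d A x = (\<Sum>j<d. ip d (U j) x * ip d (U j) (mv d A x))"
    by (rule parseval[OF eigensystem_orthonormal[OF assms(2)], symmetric])
  thus ?thesis by (simp add: ip_eigenvector_mv[OF assms] power2_eq_square mult_ac)
qed

lemma eigenvalue_qf:
  assumes "eigensystem d m A b U" "j < m"
  shows "b j = qf d A (U j)"
  using assms by (simp add: ip_mv_eigenvector orthonormal_self[OF eigensystem_orthonormal])

text \<open>On eigenvalues, \<open>0 \<le> b \<le> R\<close> gives \<open>b^2 \<le> R * b\<close>;
  hence \<open>A^2\<close> is at most \<open>R A\<close> in the Loewner order.\<close>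

lemma sqn_mv_le:
  assumes A: "symmetric_below d A" and nonneg: "\<And>x. 0 \<le> qf d A x" and le: "\<And>x. qf d A x \<le> R * sqn d x"
  shows "sqn d (mv d A x) \<le> R * qf d A x"
proof -
  obtain b U where E: "eigensystem d d A b U" using spectral_theorem[OF A] .
  note on = eigensystem_orthonormal[OF E]
  have "sqn d (mv d A x) = (\<Sum>j<d. (b j * ip d (U j) x)\<^sup>2)"
    by (subst parseval_norm[OF on, symmetric]) (simp add: ip_eigenvector_mv[OF A E])
  also have "\<dots> \<le> (\<Sum>j<d. R * (b j * (ip d (U j) x)\<^sup>2))"
  proof (intro sum_mono)
    fix j assume "j \<in> {..<d}"
    hence "0 \<le> b j" "b j \<le> R"
      using nonneg[of "U j"] le[of "U j"] eigenvalue_qf[OF E, of j] orthonormal_self[OF on, of j] by auto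
    hence "b j * (b j * (ip d (U j) x)\<^sup>2) \<le> R * (b j * (ip d (U j) x)\<^sup>2)"
      by (intro mult_right_mono) auto
    thus "(b j * ip d (U j) x)\<^sup>2 \<le> R * (b j * (ip d (U j) x)\<^sup>2)"
      by (simp add: power2_eq_square mult_ac)
  qed
  also have "\<dots> = R * qf d A x" by (simp add: qf_eigensystem[OF A E] sum_distrib_left)
  finally show ?thesis .
qed

text \<open>Cauchy-Schwarz with \<open>\<bar>a j\<bar>\<close> split evenly between both factors.
  One absolute row sum is spent, while the other weights stay attached to the individual squares and
  can still be averaged over the revealed element.\<close>

lemma weighted_square_sum_le:
  fixes a y :: "'a \<Rightarrow> real"
  shows "(\<Sum>j\<in>J. a j * y j)\<^sup>2 \<le> (\<Sum>j\<in>J. \<bar>a j\<bar>) * (\<Sum>j\<in>J. \<bar>a j\<bar> * (y j)\<^sup>2)"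
proof -
  have "a j * y j = (sgn (a j) * sqrt \<bar>a j\<bar>) * (sqrt \<bar>a j\<bar> * y j)" for j
    by (simp add: sgn_mult_abs[symmetric] mult_ac) (simp add: sgn_if)
  hence "(\<Sum>j\<in>J. a j * y j)\<^sup>2 = (\<Sum>j\<in>J. (sgn (a j) * sqrt \<bar>a j\<bar>) * (sqrt \<bar>a j\<bar> * y j))\<^sup>2"
    by (simp only:)
  also have "\<dots> \<le> (\<Sum>j\<in>J. (sgn (a j) * sqrt \<bar>a j\<bar>)\<^sup>2) * (\<Sum>j\<in>J. (sqrt \<bar>a j\<bar> * y j)\<^sup>2)"
    by (rule Cauchy_Schwarz_ineq_sum)
  also have "\<dots> = (\<Sum>j\<in>J. \<bar>a j\<bar>) * (\<Sum>j\<in>J. \<bar>a j\<bar> * (y j)\<^sup>2)"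
    by (intro arg_cong2[where f = "(*)"] sum.cong refl) (auto simp: power_mult_distrib sgn_if)
  finally show ?thesis .
qed

lemma sqn_weighted_sum_le:
  "sqn d (\<lambda>c. \<Sum>j\<in>J. a j * y j c) \<le> (\<Sum>j\<in>J. \<bar>a j\<bar>) * (\<Sum>j\<in>J. \<bar>a j\<bar> * sqn d (y j))"
proof -
  have "sqn d (\<lambda>c. \<Sum>j\<in>J. a j * y j c) = (\<Sum>c<d. (\<Sum>j\<in>J. a j * y j c)\<^sup>2)"
    by (simp add: ip_def power2_eq_square)
  also have "\<dots> \<le> (\<Sum>c<d. (\<Sum>j\<in>J. \<bar>a j\<bar>) * (\<Sum>j\<in>J. \<bar>a j\<bar> * (y j c)\<^sup>2))"
    by (intro sum_mono weighted_square_sum_le)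
  also have "\<dots> = (\<Sum>j\<in>J. \<bar>a j\<bar>) * (\<Sum>j\<in>J. \<bar>a j\<bar> * sqn d (y j))"
    unfolding sum_distrib_left[symmetric] ip_def
    by (subst sum.swap) (simp add: sum_distrib_left power2_eq_square)
  finally show ?thesis .
qed

lemma sqn_diff_le:
  "sqn d (\<lambda>a. r * x a - s * y a) \<le> 2 * r\<^sup>2 * sqn d x + 2 * s\<^sup>2 * sqn d y"
proof -
  have "0 \<le> sqn d (\<lambda>a. r * x a + s * y a)" by simp
  thus ?thesis by (simp add: ip_linear power2_eq_square algebra_simps)
qed

lemma trexp_le:
  assumes B: "symmetric_below d B" and M: "\<And>x. qf d B x \<le> M * sqn d x"
  shows "trexp d B \<le> real d * exp M"
proof -
  obtain b U where E: "eigensystem d d B b U" using spectral_theorem[OF B] .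
  have "b j \<le> M" if "j < d" for j
    using M[of "U j"] eigenvalue_qf[OF E that] orthonormal_self[OF eigensystem_orthonormal[OF E] that]
    by simp
  hence "(\<Sum>j<d. exp (b j)) \<le> (\<Sum>j<d. exp M)" by (intro sum_mono) auto
  thus ?thesis by (simp add: trexp_eigensystem[OF B E])
qed

section \<open>Homogeneous weights and influences\<close>

locale homogeneous_weight =
  fixes N :: "'a set" and w :: "'a set \<Rightarrow> real" and k :: nat
  assumes finite_N: "finite N"
    and w_nonneg: "w S \<ge> 0"
    and card_support: "S \<subseteq> N \<Longrightarrow> w S \<noteq> 0 \<Longrightarrow> card S = k"
begin

definition supersets :: "'a set \<Rightarrow> 'a set set" where
  "supersets L = {S. L \<subseteq> S \<and> S \<subseteq> N}"

text \<open>For a probability weight, \<open>W L\<close> is the probability that the random set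
  contains \<open>L\<close>, and \<open>W (insert j L) / W L\<close> is a conditional
  probability.\<close>

definition W :: "'a set \<Rightarrow> real" where
  "W L = (\<Sum>S\<in>supersets L. w S)"

lemma finite_supersets: "finite (supersets L)"
  unfolding supersets_def by (rule finite_subset[of _ "Pow N"]) (use finite_N in auto)

lemma W_nonneg: "W L \<ge> 0"
  by (simp add: W_def sum_nonneg w_nonneg)

lemma W_antimono: "L \<subseteq> L' \<Longrightarrow> W L' \<le> W L"
  unfolding W_def by (intro sum_mono2 finite_supersets w_nonneg) (auto simp: supersets_def)

lemma W_eq_0D: "W L = 0 \<Longrightarrow> S \<in> supersets L \<Longrightarrow> w S = 0"
  unfolding W_def by (simp add: sum_nonneg_eq_0_iff finite_supersets w_nonneg)

lemma W_insert_eq_0: "W (insert i L) = 0 \<Longrightarrow> W (insert j (insert i L)) = 0"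
  using W_antimono[of "insert i L" "insert j (insert i L)"] W_nonneg[of "insert j (insert i L)"] by auto

text \<open>Double counting of pairs \<open>(S, i)\<close> with \<open>i\<close> in
  \<open>S - L\<close>: by homogeneity a set of nonzero weight above \<open>L\<close> has exactly
  \<open>m\<close> such elements. This is the identity behind revealing a uniformly random element
  of \<open>S - L\<close>.\<close>

lemma sum_supersets_insert:
  assumes "L \<subseteq> N" "card L + m = k"
  shows "real m * (\<Sum>S\<in>supersets L. w S * F S) = (\<Sum>i\<in>N-L. \<Sum>S\<in>supersets (insert i L). w S * F S)"
proof -
  have "(\<Sum>i\<in>N-L. \<Sum>S\<in>supersets (insert i L). w S * F S) =
      (\<Sum>i\<in>N-L. \<Sum>S\<in>supersets L. if i \<in> S then w S * F S else 0)"
  proof (rule sum.cong[OF refl])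
    fix i
    have "supersets (insert i L) = {S \<in> supersets L. i \<in> S}" by (auto simp: supersets_def)
    thus "(\<Sum>S\<in>supersets (insert i L). w S * F S) = (\<Sum>S\<in>supersets L. if i \<in> S then w S * F S else 0)"
      by (simp only: sum.inter_filter[OF finite_supersets])
  qed
  also have "\<dots> = (\<Sum>S\<in>supersets L. \<Sum>i\<in>N-L. if i \<in> S then w S * F S else 0)" by (rule sum.swap)
  also have "\<dots> = (\<Sum>S\<in>supersets L. real m * (w S * F S))"
  proof (intro sum.cong refl)
    fix S assume S: "S \<in> supersets L"
    hence "L \<subseteq> S" "S \<subseteq> N" by (auto simp: supersets_def)
    hence "card (S - L) = card S - card L"
      using finite_subset[OF assms(1) finite_N] by (intro card_Diff_subset)
    hence "w S \<noteq> 0 \<Longrightarrow> card (S - L) = m" using card_support[OF \<open>S \<subseteq> N\<close>] assms(2) by simp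
    moreover have "(\<Sum>i\<in>N-L. if i \<in> S then w S * F S else 0) = real (card (S - L)) * (w S * F S)"
    proof -
      have "(N - L) \<inter> {i. i \<in> S} = S - L" using \<open>S \<subseteq> N\<close> by auto
      thus ?thesis using finite_N by (subst sum.If_cases) auto
    qed
    ultimately show "(\<Sum>i\<in>N-L. if i \<in> S then w S * F S else 0) = real m * (w S * F S)"
      by (cases "w S = 0") auto
  qed
  finally show ?thesis by (simp add: sum_distrib_left)
qed

lemma sum_W_insert:
  assumes "L \<subseteq> N" "card L + m = k"
  shows "(\<Sum>i\<in>N-L. W (insert i L)) = real m * W L"
  using sum_supersets_insert[OF assms, of "\<lambda>_. 1"] by (simp add: W_def)

text \<open>The term \<open>j = i\<close> is included, where the second insertion does nothing; it
  adds 1 to the \<open>m - 1\<close> elements still missing from \<open>insert i L\<close>.\<close>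

lemma sum_W_insert2:
  assumes "L \<subseteq> N" "card L + m = k" "i \<in> N - L" "m > 0"
  shows "(\<Sum>j\<in>N-L. W (insert j (insert i L))) = real m * W (insert i L)"
proof -
  have fin: "finite L" using finite_subset[OF assms(1) finite_N] .
  have "(\<Sum>j\<in>N - insert i L. W (insert j (insert i L))) = real (m - 1) * W (insert i L)"
    using assms fin by (intro sum_W_insert) auto
  moreover have NL: "N - L = insert i (N - insert i L)" using assms by auto
  have "(\<Sum>j\<in>N-L. W (insert j (insert i L))) =
      W (insert i L) + (\<Sum>j\<in>N - insert i L. W (insert j (insert i L)))"
    using finite_N by (subst NL, subst sum.insert) auto
  ultimately show ?thesis using assms(4) by (simp add: of_nat_diff algebra_simps)
qed

text \<open>Rows are truncated where \<^term>\<open>{i, j} \<union> L\<close> has weight zero, as in the influence matrix.\<close>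

definition independent :: "real \<Rightarrow> bool" where
  "independent D \<longleftrightarrow> (\<forall>L\<subseteq>N. \<forall>i\<in>N-L. W (insert i L) > 0 \<longrightarrow>
     (\<Sum>j\<in>N-L. if W (insert j (insert i L)) > 0
        then \<bar>W (insert j (insert i L)) / W (insert i L) - W (insert j L) / W L\<bar> else 0) \<le> D)"

section \<open>Influences and covariances without truncation\<close>

definition influence :: "'a set \<Rightarrow> 'a \<Rightarrow> 'a \<Rightarrow> real" where
  "influence L i j = W (insert j (insert i L)) / W (insert i L) - W (insert j L) / W L"

text \<open>\<open>W L\<close> times the conditional covariance, given \<open>L\<close>, of the
  events that \<open>i\<close> and \<open>j\<close> belong to the random set. Where
  \<open>W (insert i L) > 0\<close>, the asymmetric influence is this symmetric quantity divided by
  that weight.\<close>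

definition covar :: "'a set \<Rightarrow> 'a \<Rightarrow> 'a \<Rightarrow> real" where
  "covar L i j = W (insert j (insert i L)) - W (insert i L) * W (insert j L) / W L"

lemma covar_commute: "covar L i j = covar L j i"
  by (simp add: covar_def insert_commute mult.commute)

lemma covar_eq_influence: "W (insert i L) > 0 \<Longrightarrow> covar L i j = W (insert i L) * influence L i j"
  by (simp add: covar_def influence_def algebra_simps)

lemma covar_eq_0: "W (insert i L) = 0 \<Longrightarrow> covar L i j = 0"
  using W_insert_eq_0 by (simp add: covar_def)

text \<open>Given \<open>L\<close>, the number of remaining elements is the constant
  \<open>m\<close>, and a covariance with a constant vanishes.\<close>

lemma sum_covar:
  assumes "L \<subseteq> N" "card L + m = k" "i \<in> N - L" "m > 0"
  shows "(\<Sum>j\<in>N-L. covar L i j) = 0"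
proof (cases "W L = 0")
  case True
  hence "W (insert i L) = 0" using W_antimono[of L "insert i L"] W_nonneg[of "insert i L"] by auto
  thus ?thesis by (simp add: covar_eq_0)
next
  case False
  have "(\<Sum>j\<in>N-L. covar L i j) = (\<Sum>j\<in>N-L. W (insert j (insert i L)))
      - W (insert i L) / W L * (\<Sum>j\<in>N-L. W (insert j L))"
    by (simp add: covar_def sum_subtractf sum_distrib_left)
  thus ?thesis using False sum_W_insert2[OF assms] sum_W_insert[OF assms(1,2)] by simp
qed

text \<open>By homogeneity the rows sum to zero, so the truncated negative entries are
  controlled by the positive ones.\<close>

lemma sum_abs_influence_le:
  assumes "independent D" "L \<subseteq> N" "card L + m = k" "i \<in> N - L" "m > 0" "W (insert i L) > 0"
  shows "(\<Sum>j\<in>N-L. \<bar>influence L i j\<bar>) \<le> 2 * D"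
proof -
  define I where "I = influence L i"
  have "(\<Sum>j\<in>N-L. covar L i j) = W (insert i L) * (\<Sum>j\<in>N-L. I j)"
    by (simp add: covar_eq_influence[OF assms(6)] sum_distrib_left I_def)
  hence "W (insert i L) * (\<Sum>j\<in>N-L. I j) = 0" using sum_covar[OF assms(2-5)] by simp
  hence zero: "(\<Sum>j\<in>N-L. I j) = 0" using assms by simp
  have "(\<Sum>j\<in>N-L. max (I j) 0) \<le> (\<Sum>j\<in>N-L. if W (insert j (insert i L)) > 0 then \<bar>I j\<bar> else 0)"
  proof (intro sum_mono)
    fix j
    have "I j \<le> 0" if "\<not> W (insert j (insert i L)) > 0"
    proof -
      have "W (insert j (insert i L)) = 0" using that W_nonneg[of "insert j (insert i L)"] by simp
      thus ?thesis by (simp add: I_def influence_def W_nonneg)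
    qed
    thus "max (I j) 0 \<le> (if W (insert j (insert i L)) > 0 then \<bar>I j\<bar> else 0)" by auto
  qed
  also have "\<dots> \<le> D" using assms unfolding independent_def I_def influence_def by blast
  finally have "(\<Sum>j\<in>N-L. max (I j) 0) \<le> D" .
  moreover have "\<bar>I j\<bar> = 2 * max (I j) 0 - I j" for j by auto
  hence "(\<Sum>j\<in>N-L. \<bar>I j\<bar>) = 2 * (\<Sum>j\<in>N-L. max (I j) 0) - (\<Sum>j\<in>N-L. I j)"
    by (simp add: sum_subtractf sum_distrib_left)
  ultimately show ?thesis using zero by (simp add: I_def)
qed

lemma sum_abs_covar_le:
  assumes "independent D" "L \<subseteq> N" "card L + m = k" "i \<in> N - L" "m > 0"
  shows "(\<Sum>j\<in>N-L. \<bar>covar L i j\<bar>) \<le> 2 * D * W (insert i L)"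
proof (cases "W (insert i L) = 0")
  case False
  hence pos: "W (insert i L) > 0" using W_nonneg[of "insert i L"] by simp
  have "(\<Sum>j\<in>N-L. \<bar>covar L i j\<bar>) = W (insert i L) * (\<Sum>j\<in>N-L. \<bar>influence L i j\<bar>)"
    using pos by (simp add: covar_eq_influence abs_mult sum_distrib_left)
  thus ?thesis using sum_abs_influence_le[OF assms pos] pos by (simp add: mult.commute)
qed (simp add: covar_eq_0)

text \<open>Inclusion-exclusion, the union being contained in the event for \<open>L\<close>. Two
  elements of conditional probability above 1/2 therefore occur together with positive
  weight.\<close>

lemma W_insert_add_le: "W (insert i L) + W (insert j L) \<le> W L + W (insert i (insert j L))"
proof -
  have "W (insert i L) + W (insert j L) =
      sum w (supersets (insert i L) \<union> supersets (insert j L)) +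
      sum w (supersets (insert i L) \<inter> supersets (insert j L))"
    unfolding W_def by (rule sum.union_inter[symmetric]) (rule finite_supersets)+
  also have "supersets (insert i L) \<inter> supersets (insert j L) = supersets (insert i (insert j L))"
    by (auto simp: supersets_def)
  also have "sum w (supersets (insert i L) \<union> supersets (insert j L)) \<le> W L"
    unfolding W_def by (intro sum_mono2 finite_supersets w_nonneg) (auto simp: supersets_def)
  finally show ?thesis by (simp add: W_def)
qed

lemma W_pos: "S \<in> supersets L \<Longrightarrow> w S \<noteq> 0 \<Longrightarrow> W L > 0"
  using W_eq_0D W_nonneg[of L] by (metis order.order_iff_strict)

text \<open>The diagonal influence of a feasible element is its conditional probability of absence, so
  for \<open>D < 1/2\<close> any two feasible elements occur together in some set of positive weight.\<close>

lemma support_unique: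
  assumes indep: "independent D" and D: "D < 1 / 2"
    and S: "S \<subseteq> N" "w S \<noteq> 0" and S': "S' \<subseteq> N" "w S' \<noteq> 0"
  shows "S = S'"
proof -
  have "S = S'" if "S \<in> supersets L" "w S \<noteq> 0" "S' \<in> supersets L" "w S' \<noteq> 0" "card L + m = k" "L \<subseteq> N"
    for L m S S'
    using that
  proof (induction m arbitrary: L S S')
    case 0
    have "T = L" if "T \<in> supersets L" "w T \<noteq> 0" for T
    proof -
      have T: "L \<subseteq> T" "T \<subseteq> N" "card T = card L"
        using that card_support[of T] 0 by (auto simp: supersets_def)
      moreover have "finite T" using T finite_N finite_subset by blast
      ultimately show ?thesis using card_subset_eq[of T L] by simp
    qed
    thus ?case using 0 by metis
  next
    case (Suc m)
    have fin: "finite L" using Suc.prems finite_N finite_subset by blast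
    have new: "\<exists>i. i \<in> T - L" if "T \<in> supersets L" "w T \<noteq> 0" for T
    proof (rule ccontr)
      assume "\<nexists>i. i \<in> T - L"
      hence "T = L" using that by (auto simp: supersets_def)
      thus False using card_support[of T] that Suc.prems by (auto simp: supersets_def)
    qed
    obtain i j where i: "i \<in> S - L" and j: "j \<in> S' - L"
      using new[of S] new[of S'] Suc.prems by blast
    have half: "W (insert l L) > W L / 2" if T: "T \<in> supersets L" "w T \<noteq> 0" "l \<in> T - L" for T l
    proof -
      have l: "l \<in> N - L" and pos: "W (insert l L) > 0" and WL: "W L > 0"
        using T W_pos[of T "insert l L"] W_pos[of T L] by (auto simp: supersets_def)
      have "1 - W (insert l L) / W L \<le> (\<Sum>j\<in>N-L. if W (insert j (insert l L)) > 0
          then \<bar>W (insert j (insert l L)) / W (insert l L) - W (insert j L) / W L\<bar> else 0)"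
        using l pos finite_N
        by (intro order.trans[OF _ member_le_sum[of l]]) auto
      also have "\<dots> \<le> D" using indep Suc.prems l pos unfolding independent_def by blast
      finally have "W (insert l L) / W L > 1 / 2" using D by linarith
      thus ?thesis using WL by (simp add: field_simps)
    qed
    have "W (insert i (insert j L)) > 0"
      using half[of S i] half[of S' j] i j Suc.prems W_insert_add_le[of i L j] by auto
    then obtain T where T: "T \<in> supersets (insert i (insert j L))" "w T \<noteq> 0"
      unfolding W_def by (metis less_irrefl sum.neutral)
    \<comment> \<open>\<open>T\<close> is a bridge: it shares \<open>i\<close> with \<open>S\<close>
      and \<open>j\<close> with \<open>S'\<close>, so the induction hypothesis applies above
      \<open>insert i L\<close> and above \<open>insert j L\<close>.\<close>
    have "S = T" using Suc.prems i T fin by (intro Suc.IH[of S "insert i L" T]) (auto simp: supersets_def)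
    moreover have "S' = T" using Suc.prems j T fin by (intro Suc.IH[of S' "insert j L" T]) (auto simp: supersets_def)
    ultimately show ?case by simp
  qed
  from this[of S "{}" S' k] S S' show ?thesis by (simp add: supersets_def)
qed

end

section \<open>The supermartingale\<close>

locale matrix_family = homogeneous_weight N w k for N :: "'a set" and w k +
  fixes d :: nat and Y :: "'a \<Rightarrow> nat \<Rightarrow> nat \<Rightarrow> real" and R D :: real
  assumes sym_Y: "i \<in> N \<Longrightarrow> symmetric_below d (Y i)"
    and qf_Y_nonneg: "i \<in> N \<Longrightarrow> 0 \<le> qf d (Y i) x"
    and qf_Y_le: "i \<in> N \<Longrightarrow> qf d (Y i) x \<le> R * sqn d x"
    and R_pos: "R > 0"
    and indep: "independent D"
begin

lemma sqn_Y_le: "i \<in> N \<Longrightarrow> sqn d (mv d (Y i) x) \<le> R * qf d (Y i) x"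
  by (rule sqn_mv_le[OF sym_Y qf_Y_nonneg qf_Y_le])

text \<open>The matrix \<open>M\<close> of the overview: for \<open>i\<close> in
  \<open>N - L\<close> with \<open>W (insert i L) > 0\<close> it equals
  \<open>Y i + mean_mat (insert i L) - mean_mat L\<close>, where \<open>mean_mat\<close> is
  \<open>Z\<close>.\<close>

definition drift_mat :: "'a set \<Rightarrow> 'a \<Rightarrow> nat \<Rightarrow> nat \<Rightarrow> real" where
  "drift_mat L i = (\<lambda>a c. \<Sum>j\<in>N-L. influence L i j * Y j a c)"

definition mean_mat :: "'a set \<Rightarrow> nat \<Rightarrow> nat \<Rightarrow> real" where
  "mean_mat L = (\<lambda>a c. \<Sum>j\<in>N-L. W (insert j L) / W L * Y j a c)"

context
  fixes L m assumes L: "L \<subseteq> N" "card L + m = k" "m > 0"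
begin

lemma mv_drift_mat: "mv d (drift_mat L i) x = (\<lambda>a. \<Sum>j\<in>N-L. influence L i j * mv d (Y j) x a)"
  unfolding drift_mat_def by (simp add: mv_mat_sum mv_mat_linear)

text \<open>The first bound keeps the quadratic forms of the \<open>Y j\<close>, so that averaging
  over \<open>i\<close> yields a multiple of \<open>Z\<close>; the second is a plain norm bound that
  makes the perturbation a contraction.\<close>

lemma sqn_drift_mat_le:
  assumes "i \<in> N - L" "W (insert i L) > 0"
  shows "sqn d (mv d (drift_mat L i) x) \<le> 2 * D * R * (\<Sum>j\<in>N-L. \<bar>influence L i j\<bar> * qf d (Y j) x)"
    and "sqn d (mv d (drift_mat L i) x) \<le> 4 * D\<^sup>2 * R\<^sup>2 * sqn d x"
proof -
  define s where "s = (\<Sum>j\<in>N-L. \<bar>influence L i j\<bar>)"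
  define z where "z = (\<Sum>j\<in>N-L. \<bar>influence L i j\<bar> * qf d (Y j) x)"
  have s: "0 \<le> s" "s \<le> 2 * D"
    using sum_abs_influence_le[OF indep L(1,2) assms(1) L(3) assms(2)] by (auto simp: s_def sum_nonneg)
  have z: "z \<ge> 0" unfolding z_def by (intro sum_nonneg mult_nonneg_nonneg) (auto simp: qf_Y_nonneg)
  have "sqn d (mv d (drift_mat L i) x) \<le> s * (\<Sum>j\<in>N-L. \<bar>influence L i j\<bar> * sqn d (mv d (Y j) x))"
    unfolding mv_drift_mat s_def by (rule sqn_weighted_sum_le)
  also have "\<dots> \<le> s * (\<Sum>j\<in>N-L. \<bar>influence L i j\<bar> * (R * qf d (Y j) x))"
    using s by (intro mult_left_mono sum_mono sqn_Y_le) auto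
  also have "\<dots> = s * (R * z)" by (simp add: z_def sum_distrib_left mult_ac)
  finally have le: "sqn d (mv d (drift_mat L i) x) \<le> s * (R * z)" .
  also have "\<dots> \<le> 2 * D * (R * z)" using s z R_pos by (intro mult_right_mono) auto
  finally show "sqn d (mv d (drift_mat L i) x) \<le> 2 * D * R * z" by (simp add: mult_ac)
  have "z \<le> (\<Sum>j\<in>N-L. \<bar>influence L i j\<bar> * (R * sqn d x))"
    unfolding z_def by (intro sum_mono mult_left_mono qf_Y_le) auto
  also have "\<dots> = s * (R * sqn d x)" by (simp only: s_def sum_distrib_right)
  finally have "s * (R * z) \<le> s * (R * (s * (R * sqn d x)))"
    using s R_pos by (intro mult_left_mono) auto
  also have "\<dots> = s\<^sup>2 * (R\<^sup>2 * sqn d x)" by (simp add: power2_eq_square mult_ac)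
  also have "\<dots> \<le> (2 * D)\<^sup>2 * (R\<^sup>2 * sqn d x)"
    using s by (intro mult_right_mono power_mono) auto
  finally show "sqn d (mv d (drift_mat L i) x) \<le> 4 * D\<^sup>2 * R\<^sup>2 * sqn d x"
    using le by (simp add: power_mult_distrib mult_ac)
qed

text \<open>The condition on \<open>g\<close> is a budget. For \<open>X = \<phi> M - g Y\<close>,
  the form \<open>2 X^2\<close> is at most \<open>4 \<phi>^2 M^2 + 4 g^2 Y^2\<close>, whose averages
  are at most \<open>16 \<phi>^2 D^2 R z\<close> and \<open>4 g^2 R z\<close>, while the drift pays
  \<open>g z\<close>; here \<open>z\<close> is the form of \<open>Z / m\<close>.\<close>

lemma trexp_step:
  assumes H: "symmetric_below d H" and WL: "W L > 0"
    and g: "g \<ge> 0" "16 * \<phi>\<^sup>2 * D\<^sup>2 * R + 4 * g\<^sup>2 * R \<le> g"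
  shows "(\<Sum>i\<in>N-L. W (insert i L) * trexp d (\<lambda>a c. H a c + (\<phi> * drift_mat L i a c - g * Y i a c)))
      \<le> real m * W L * trexp d H"
proof -
  define I where "I = {i \<in> N - L. W (insert i L) > 0}"
  \<comment> \<open>The law of a uniformly random element of \<open>S - L\<close>, for
    \<open>S\<close> drawn with weight \<open>w\<close> above \<open>L\<close>.\<close>
  define q where "q = (\<lambda>i. W (insert i L) / (real m * W L))"
  define X where "X = (\<lambda>i a c. \<phi> * drift_mat L i a c - g * Y i a c)"
  have den: "real m * W L > 0" using L WL by simp
  have finI: "finite (N - L)" using finite_N by simp
  \<comment> \<open>Row bounds are available only for \<open>i\<close> in \<open>I\<close>; the
    other elements carry no weight, so weighted sums pass freely between \<open>I\<close> and
    \<open>N - L\<close>.\<close>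
  have restrict: "(\<Sum>i\<in>I. f i) = (\<Sum>i\<in>N-L. f i)" if "\<And>i. W (insert i L) = 0 \<Longrightarrow> f i = 0" for f :: "'a \<Rightarrow> real"
    unfolding I_def using W_nonneg finI
    by (intro sum.mono_neutral_left) (auto intro!: that simp: order.order_iff_strict)
  have q_nonneg: "q i \<ge> 0" for i unfolding q_def using den W_nonneg by simp
  have "(\<Sum>i\<in>I. q i) = (\<Sum>i\<in>N-L. q i)" by (rule restrict) (simp add: q_def)
  also have "\<dots> = 1" unfolding q_def sum_divide_distrib[symmetric] sum_W_insert[OF L(1,2)]
    by (rule divide_self) (use den in linarith)
  finally have q_sum: "(\<Sum>i\<in>I. q i) = 1" .
  have qa: "q i * influence L i j = covar L i j / (real m * W L)" if "i \<in> I" for i j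
    using covar_eq_influence[of i L j] that unfolding q_def I_def by simp
  have mvX: "mv d (X i) x = (\<lambda>a. \<phi> * mv d (drift_mat L i) x a - g * mv d (Y i) x a)" for i x
    by (simp add: X_def mv_mat_linear)
  have sqnX: "sqn d (mv d (X i) x) \<le> 2 * \<phi>\<^sup>2 * sqn d (mv d (drift_mat L i) x) + 2 * g\<^sup>2 * sqn d (mv d (Y i) x)" for i x
    unfolding mvX by (rule sqn_diff_le)
  have gR: "g * R \<le> 1"
  proof (cases "g = 0")
    case False
    have "16 * \<phi>\<^sup>2 * D\<^sup>2 * R \<ge> 0" using R_pos by simp
    hence "4 * g\<^sup>2 * R \<le> g" using g by linarith
    hence "g * (4 * (g * R)) \<le> g * 1" by (simp add: power2_eq_square mult_ac)
    thus ?thesis using False g by (subst (asm) mult_le_cancel_left_pos) auto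
  qed simp
  have contraction: "sqn d (mv d (X i) x) \<le> sqn d x" if i: "i \<in> I" for i x
  proof -
    have iN: "i \<in> N" "i \<in> N - L" "W (insert i L) > 0" using i by (auto simp: I_def)
    have "sqn d (mv d (Y i) x) \<le> R * (R * sqn d x)"
      by (rule order.trans[OF sqn_Y_le[OF iN(1)] mult_left_mono[OF qf_Y_le[OF iN(1)]]]) (use R_pos in simp)
    hence "sqn d (mv d (X i) x) \<le> 2 * \<phi>\<^sup>2 * (4 * D\<^sup>2 * R\<^sup>2 * sqn d x) + 2 * g\<^sup>2 * (R * (R * sqn d x))"
      by (intro order.trans[OF sqnX] add_mono mult_left_mono sqn_drift_mat_le iN) auto
    \<comment> \<open>The budget condition serves a second time: multiplied by \<open>R / 2\<close>
      it bounds the squared norm of the perturbation by \<open>g R / 2\<close>, at most 1/2.\<close>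
    also have "\<dots> = ((16 * \<phi>\<^sup>2 * D\<^sup>2 * R + 4 * g\<^sup>2 * R) * (R * sqn d x)) / 2"
      by (simp add: power2_eq_square algebra_simps)
    also have "\<dots> \<le> (g * (R * sqn d x)) / 2"
      using g R_pos by (intro divide_right_mono mult_right_mono) auto
    also have "\<dots> = (g * R) * sqn d x / 2" by simp
    also have "\<dots> \<le> 1 * sqn d x / 2" by (intro divide_right_mono mult_right_mono gR) auto
    finally show ?thesis using ip_self_nonneg[of d x] by linarith
  qed
  have drift: "(\<Sum>i\<in>I. q i * (qf d (X i) x + 2 * sqn d (mv d (X i) x))) \<le> 0" for x
  proof -
    define y where "y = (\<lambda>j. qf d (Y j) x)"
    define z where "z = (\<Sum>i\<in>N-L. q i * y i)"
    have y: "y j \<ge> 0" if "j \<in> N" for j using that by (simp add: y_def qf_Y_nonneg)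
    have z: "z \<ge> 0" unfolding z_def by (intro sum_nonneg mult_nonneg_nonneg q_nonneg y) auto
    have zI: "(\<Sum>i\<in>I. q i * y i) = z" unfolding z_def by (rule restrict) (simp add: q_def)
    have qfX: "qf d (X i) x = \<phi> * (\<Sum>j\<in>N-L. influence L i j * y j) - g * y i" for i
      by (simp add: mvX ip_linear mv_drift_mat y_def)
    have first: "(\<Sum>i\<in>I. q i * qf d (X i) x) = - g * z"
    proof -
      have "(\<Sum>i\<in>I. q i * (\<Sum>j\<in>N-L. influence L i j * y j)) =
          (\<Sum>i\<in>I. \<Sum>j\<in>N-L. covar L i j / (real m * W L) * y j)"
        by (simp add: sum_distrib_left mult.assoc[symmetric] qa)
      also have "\<dots> = (\<Sum>i\<in>N-L. \<Sum>j\<in>N-L. covar L i j / (real m * W L) * y j)"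
        by (rule restrict) (simp add: covar_eq_0)
      \<comment> \<open>Averaging over the revealed \<open>i\<close> is a column sum; symmetry turns
        it into a row sum, to which \<open>sum_covar\<close> applies.\<close>
      also have "\<dots> = (\<Sum>j\<in>N-L. (\<Sum>i\<in>N-L. covar L j i) / (real m * W L) * y j)"
        by (subst sum.swap) (simp add: covar_commute[of L] sum_divide_distrib sum_distrib_right)
      also have "\<dots> = 0" using sum_covar[OF L(1,2) _ L(3)] by (intro sum.neutral) auto
      finally have "(\<Sum>i\<in>I. q i * (\<Sum>j\<in>N-L. influence L i j * y j)) = 0" .
      moreover have "(\<Sum>i\<in>I. q i * qf d (X i) x) =
          \<phi> * (\<Sum>i\<in>I. q i * (\<Sum>j\<in>N-L. influence L i j * y j)) - g * (\<Sum>i\<in>I. q i * y i)"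
        unfolding qfX sum_distrib_left[of \<phi> _ I] sum_distrib_left[of g _ I] sum_subtractf[symmetric]
        by (intro sum.cong refl) (simp add: algebra_simps)
      ultimately show ?thesis by (simp add: zI)
    qed
    have second: "(\<Sum>i\<in>I. q i * sqn d (mv d (drift_mat L i) x)) \<le> 4 * D\<^sup>2 * R * z"
    proof -
      \<comment> \<open>The sign of \<open>D\<close> is read off from any row bound, hence from
        \<open>I\<close> being nonempty; an empty \<open>I\<close> contradicts
        \<open>q_sum\<close>.\<close>
      have D: "2 * D \<ge> 0" if "i \<in> I" for i
      proof -
        have "0 \<le> (\<Sum>j\<in>N-L. \<bar>influence L i j\<bar>)" by (intro sum_nonneg) auto
        also have "\<dots> \<le> 2 * D"
          using that by (intro sum_abs_influence_le[OF indep L(1,2) _ L(3)]) (auto simp: I_def)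
        finally show ?thesis .
      qed
      have "(\<Sum>i\<in>I. q i * sqn d (mv d (drift_mat L i) x)) \<le>
          (\<Sum>i\<in>I. q i * (2 * D * R * (\<Sum>j\<in>N-L. \<bar>influence L i j\<bar> * y j)))"
        unfolding y_def by (intro sum_mono mult_left_mono sqn_drift_mat_le q_nonneg) (auto simp: I_def)
      also have "\<dots> = 2 * D * R * (\<Sum>i\<in>I. \<Sum>j\<in>N-L. \<bar>covar L i j\<bar> / (real m * W L) * y j)"
      proof -
        have "q i * \<bar>influence L i j\<bar> = \<bar>covar L i j\<bar> / (real m * W L)" if "i \<in> I" for i j
          using qa[OF that, of j] q_nonneg[of i] den by (metis abs_divide abs_mult abs_of_nonneg less_imp_le)
        hence "(\<Sum>i\<in>I. \<Sum>j\<in>N-L. \<bar>covar L i j\<bar> / (real m * W L) * y j) =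
            (\<Sum>i\<in>I. \<Sum>j\<in>N-L. q i * \<bar>influence L i j\<bar> * y j)"
          by (intro sum.cong refl) simp
        thus ?thesis by (simp add: sum_distrib_left mult_ac)
      qed
      also have "(\<Sum>i\<in>I. \<Sum>j\<in>N-L. \<bar>covar L i j\<bar> / (real m * W L) * y j) =
          (\<Sum>i\<in>N-L. \<Sum>j\<in>N-L. \<bar>covar L i j\<bar> / (real m * W L) * y j)"
        by (rule restrict) (simp add: covar_eq_0)
      also have "\<dots> = (\<Sum>j\<in>N-L. (\<Sum>i\<in>N-L. \<bar>covar L j i\<bar>) / (real m * W L) * y j)"
        by (subst sum.swap) (simp add: covar_commute[of L] sum_divide_distrib sum_distrib_right)
      also have "2 * D * R * \<dots> \<le> 2 * D * R * (\<Sum>j\<in>N-L. 2 * D * W (insert j L) / (real m * W L) * y j)"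
      proof (cases "I = {}")
        case False
        hence "2 * D * R \<ge> 0" using D R_pos by fastforce
        thus ?thesis using den
          by (intro mult_left_mono sum_mono mult_right_mono divide_right_mono
            sum_abs_covar_le[OF indep L(1,2) _ L(3)] y) auto
      next
        case True
        thus ?thesis using q_sum by simp
      qed
      also have "\<dots> = 4 * D\<^sup>2 * R * z"
        by (simp add: z_def q_def sum_distrib_left power2_eq_square mult_ac)
      finally show ?thesis .
    qed
    have third: "(\<Sum>i\<in>I. q i * sqn d (mv d (Y i) x)) \<le> R * z"
    proof -
      have "(\<Sum>i\<in>I. q i * sqn d (mv d (Y i) x)) \<le> (\<Sum>i\<in>I. q i * (R * y i))"
        unfolding y_def by (intro sum_mono mult_left_mono sqn_Y_le q_nonneg) (auto simp: I_def)
      also have "\<dots> = R * z" by (simp add: zI[symmetric] sum_distrib_left mult_ac)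
      finally show ?thesis .
    qed
    have "(\<Sum>i\<in>I. q i * (qf d (X i) x + 2 * sqn d (mv d (X i) x))) \<le>
        (\<Sum>i\<in>I. q i * (qf d (X i) x + 2 * (2 * \<phi>\<^sup>2 * sqn d (mv d (drift_mat L i) x) + 2 * g\<^sup>2 * sqn d (mv d (Y i) x))))"
      by (intro sum_mono mult_left_mono add_mono order.refl sqnX q_nonneg) auto
    also have "\<dots> = (\<Sum>i\<in>I. q i * qf d (X i) x) + 4 * \<phi>\<^sup>2 * (\<Sum>i\<in>I. q i * sqn d (mv d (drift_mat L i) x))
        + 4 * g\<^sup>2 * (\<Sum>i\<in>I. q i * sqn d (mv d (Y i) x))"
      unfolding sum_distrib_left sum.distrib[symmetric]
      by (intro sum.cong refl) (simp add: algebra_simps)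
    also have "\<dots> \<le> - g * z + 4 * \<phi>\<^sup>2 * (4 * D\<^sup>2 * R * z) + 4 * g\<^sup>2 * (R * z)"
      unfolding first by (intro add_mono mult_left_mono second third order.refl) auto
    also have "\<dots> = (16 * \<phi>\<^sup>2 * D\<^sup>2 * R + 4 * g\<^sup>2 * R - g) * z" by (simp add: algebra_simps)
    also have "\<dots> \<le> 0" using g z by (intro mult_nonpos_nonneg) auto
    finally show ?thesis .
  qed
  have symX: "symmetric_below d (X i)" if "i \<in> I" for i
    unfolding X_def drift_mat_def using that
    by (intro symmetric_below_diff symmetric_below_scale symmetric_below_sum sym_Y) (auto simp: I_def)
  have "(\<Sum>i\<in>I. q i * trexp d (\<lambda>a c. H a c + X i a c)) \<le> trexp d H"
    using trexp_average[OF H symX contraction q_nonneg q_sum drift] .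
  hence "(\<Sum>i\<in>N-L. q i * trexp d (\<lambda>a c. H a c + X i a c)) \<le> trexp d H"
    by (subst (asm) restrict) (simp_all add: q_def)
  hence "real m * W L * (\<Sum>i\<in>N-L. q i * trexp d (\<lambda>a c. H a c + X i a c)) \<le> real m * W L * trexp d H"
    using den by (intro mult_left_mono) auto
  also have "real m * W L * (\<Sum>i\<in>N-L. q i * trexp d (\<lambda>a c. H a c + X i a c)) =
      (\<Sum>i\<in>N-L. W (insert i L) * trexp d (\<lambda>a c. H a c + X i a c))"
    using L(3) WL by (simp add: q_def sum_distrib_left)
  finally show ?thesis by (simp only: X_def)
qed

end

text \<open>Induction on the number \<open>m\<close> of unrevealed elements. \<open>H\<close> is
  arbitrary so that it can absorb \<open>(\<phi> - g) * Y i\<close> for each revealed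
  \<open>i\<close>; at \<open>m = 0\<close> only \<open>L\<close> itself carries weight and the mean
  of the rest is zero.\<close>

theorem trexp_mgf:
  assumes H: "symmetric_below d H" and L: "L \<subseteq> N" "card L + m = k"
    and g: "g \<ge> 0" "16 * \<phi>\<^sup>2 * D\<^sup>2 * R + 4 * g\<^sup>2 * R \<le> g"
  shows "(\<Sum>S\<in>supersets L. w S * trexp d (\<lambda>a c. H a c + (\<phi> - g) * (\<Sum>i\<in>S-L. Y i a c)))
      \<le> W L * trexp d (\<lambda>a c. H a c + \<phi> * mean_mat L a c)"
  using H L
proof (induction m arbitrary: L H)
  case 0
  have fin: "finite L" by (rule finite_subset[OF 0(2) finite_N])
  have "w S = 0" if "S \<in> supersets L" "S \<noteq> L" for S
  proof (rule ccontr)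
    assume "w S \<noteq> 0"
    hence "card S = card L" using that 0 card_support by (auto simp: supersets_def)
    thus False using that fin finite_N card_subset_eq[of S L]
      by (auto simp: supersets_def dest: finite_subset)
  qed
  hence *: "(\<Sum>S\<in>supersets L. w S * F S) = w L * F L" for F
    using 0 by (subst sum.mono_neutral_right[OF finite_supersets, of "{L}"]) (auto simp: supersets_def)
  have "W (insert j L) = 0" if "j \<in> N - L" for j
  proof -
    have "w S = 0" if S: "S \<in> supersets (insert j L)" for S
      using \<open>\<And>S. \<lbrakk>S \<in> supersets L; S \<noteq> L\<rbrakk> \<Longrightarrow> w S = 0\<close>[of S] S \<open>j \<in> N - L\<close> by (auto simp: supersets_def)
    thus ?thesis by (simp add: W_def)
  qed
  hence "mean_mat L = (\<lambda>a c. 0)" by (simp add: mean_mat_def)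
  thus ?case using *[of "\<lambda>_. 1"] by (simp add: * W_def)
next
  case (Suc m)
  show ?case
  proof (cases "W L = 0")
    case True
    thus ?thesis using W_eq_0D by simp
  next
    case False
    hence WL: "W L > 0" using W_nonneg[of L] by simp
    define B where "B = (\<lambda>a c. H a c + \<phi> * mean_mat L a c)"
    have symB: "symmetric_below d B" unfolding B_def mean_mat_def
      by (intro symmetric_below_add Suc.prems symmetric_below_scale symmetric_below_sum sym_Y) auto
    have fin: "finite L" by (rule finite_subset[OF Suc.prems(2) finite_N])
    have "real (Suc m) * (\<Sum>S\<in>supersets L. w S * trexp d (\<lambda>a c. H a c + (\<phi> - g) * (\<Sum>i\<in>S-L. Y i a c)))
      = (\<Sum>i\<in>N-L. \<Sum>S\<in>supersets (insert i L). w S * trexp d (\<lambda>a c. H a c + (\<phi> - g) * (\<Sum>i\<in>S-L. Y i a c)))"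
      using Suc.prems by (intro sum_supersets_insert) auto
    also have "\<dots> \<le> (\<Sum>i\<in>N-L. W (insert i L) * trexp d (\<lambda>a c. B a c + (\<phi> * drift_mat L i a c - g * Y i a c)))"
    proof (intro sum_mono)
      fix i assume i: "i \<in> N - L"
      define H' where "H' = (\<lambda>a c. H a c + (\<phi> - g) * Y i a c)"
      have "(\<Sum>S\<in>supersets (insert i L). w S * trexp d (\<lambda>a c. H a c + (\<phi> - g) * (\<Sum>i\<in>S-L. Y i a c)))
        = (\<Sum>S\<in>supersets (insert i L). w S * trexp d (\<lambda>a c. H' a c + (\<phi> - g) * (\<Sum>i\<in>S-insert i L. Y i a c)))"
      proof (intro sum.cong refl)
        fix S assume S: "S \<in> supersets (insert i L)"
        hence SL: "S - L = insert i (S - insert i L)" and fS: "finite S"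
          using i finite_N by (auto simp: supersets_def intro: finite_subset)
        have "(\<Sum>i\<in>S-L. Y i a c) = Y i a c + (\<Sum>i\<in>S-insert i L. Y i a c)" for a c
          by (subst SL, subst sum.insert) (auto simp: fS)
        thus "w S * trexp d (\<lambda>a c. H a c + (\<phi> - g) * (\<Sum>i\<in>S-L. Y i a c)) =
          w S * trexp d (\<lambda>a c. H' a c + (\<phi> - g) * (\<Sum>i\<in>S-insert i L. Y i a c))"
          by (simp add: H'_def algebra_simps)
      qed
      also have "\<dots> \<le> W (insert i L) * trexp d (\<lambda>a c. H' a c + \<phi> * mean_mat (insert i L) a c)"
        using Suc.prems i fin
        by (intro Suc.IH) (auto simp: H'_def intro!: symmetric_below_add symmetric_below_scale sym_Y)
      also have "\<dots> = W (insert i L) * trexp d (\<lambda>a c. B a c + (\<phi> * drift_mat L i a c - g * Y i a c))"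
      proof (cases "W (insert i L) = 0")
        case False
        have NL: "N - L = insert i (N - insert i L)" using i by auto
        have mean: "mean_mat L a c + drift_mat L i a c = Y i a c + mean_mat (insert i L) a c" for a c
        proof -
          have "mean_mat L a c + drift_mat L i a c =
              (\<Sum>j\<in>N-L. W (insert j (insert i L)) / W (insert i L) * Y j a c)"
            unfolding mean_mat_def drift_mat_def influence_def sum.distrib[symmetric]
            by (intro sum.cong refl) (simp add: algebra_simps)
          also have "\<dots> = Y i a c + mean_mat (insert i L) a c"
            unfolding mean_mat_def using False finite_N by (subst NL, subst sum.insert) auto
          finally show ?thesis .
        qed
        \<comment> \<open>Revealing \<open>i\<close> moves \<open>Y i\<close> from weight
          \<open>\<phi>\<close> to weight \<open>\<phi> - g\<close> and changes the total mean by
          \<open>drift_mat L i\<close>; the net change is the perturbation of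
          \<open>trexp_step\<close>.\<close>
        have "H' a c + \<phi> * mean_mat (insert i L) a c = B a c + (\<phi> * drift_mat L i a c - g * Y i a c)" for a c
        proof -
          have "\<phi> * mean_mat (insert i L) a c = \<phi> * (mean_mat L a c + drift_mat L i a c - Y i a c)"
            by (simp add: mean)
          thus ?thesis by (simp add: H'_def B_def algebra_simps)
        qed
        thus ?thesis by simp
      qed simp
      finally show "(\<Sum>S\<in>supersets (insert i L). w S * trexp d (\<lambda>a c. H a c + (\<phi> - g) * (\<Sum>i\<in>S-L. Y i a c)))
        \<le> W (insert i L) * trexp d (\<lambda>a c. B a c + (\<phi> * drift_mat L i a c - g * Y i a c))" .
    qed
    also have "\<dots> \<le> real (Suc m) * W L * trexp d B"
      using Suc.prems by (intro trexp_step symB WL g) auto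
    finally show ?thesis unfolding B_def by (simp del: of_nat_Suc add: mult.assoc)
  qed
qed

end

section \<open>Markov's inequality and the choice of parameters\<close>

context matrix_family
begin

text \<open>Markov's inequality for the trace exponential, started with nothing revealed. The
  dimension factor comes from bounding each of the \<open>d\<close> terms of the trace at the mean
  by \<open>exp M\<close>.\<close>

lemma exponential_tail:
  assumes total: "W {} = 1"
    and g: "g \<ge> 0" "16 * \<phi>\<^sup>2 * D\<^sup>2 * R + 4 * g\<^sup>2 * R \<le> g"
    and E: "E \<subseteq> Pow N" "\<And>S. S \<in> E \<Longrightarrow> exp s \<le> trexp d (\<lambda>a c. (\<phi> - g) * (\<Sum>i\<in>S. Y i a c))"
    and M: "\<And>x. \<phi> * qf d (mean_mat {}) x \<le> M * sqn d x"
  shows "(\<Sum>S\<in>E. w S) \<le> real d * exp (M - s)"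
proof -
  have sym_mean: "symmetric_below d (mean_mat {})"
    unfolding mean_mat_def by (intro symmetric_below_sum symmetric_below_scale sym_Y) auto
  define T where "T = (\<lambda>S. trexp d (\<lambda>a c. (\<phi> - g) * (\<Sum>i\<in>S. Y i a c)))"
  have T: "T S \<ge> 0" for S by (simp add: T_def trexp_def sum_nonneg)
  have sup: "supersets {} = Pow N" by (auto simp: supersets_def)
  have "(\<Sum>S\<in>E. w S) * exp s = (\<Sum>S\<in>E. w S * exp s)" by (simp add: sum_distrib_right)
  also have "\<dots> \<le> (\<Sum>S\<in>E. w S * T S)"
    using E by (intro sum_mono mult_left_mono w_nonneg) (auto simp: T_def)
  also have "\<dots> \<le> (\<Sum>S\<in>Pow N. w S * T S)"
    using E T w_nonneg finite_N by (intro sum_mono2) auto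
  also have "\<dots> \<le> trexp d (\<lambda>a c. \<phi> * mean_mat {} a c)"
    using trexp_mgf[of "\<lambda>a c. 0" "{}" k g \<phi>] g total by (simp add: sup T_def symmetric_below_def)
  also have "\<dots> \<le> real d * exp M"
  proof (rule trexp_le)
    show "symmetric_below d (\<lambda>a c. \<phi> * mean_mat {} a c)" by (rule symmetric_below_scale[OF sym_mean])
    show "qf d (\<lambda>a c. \<phi> * mean_mat {} a c) x \<le> M * sqn d x" for x
      using M[of x] by (simp add: mv_mat_linear ip_linear)
  qed
  finally show ?thesis by (simp add: exp_diff field_simps)
qed

text \<open>Since \<open>D\<^sup>2 * R * \<theta>\<^sup>2 = \<delta> * \<theta> / 200\<close>, the
  budget lives at scale \<open>\<delta> * \<theta>\<close>: the variance costs at most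
  \<open>16 * 1.21 / 200 = 0.0968\<close> of it and the square of \<open>g\<close> at most 0.0008,
  within the 0.1 that \<open>g\<close> provides.\<close>

lemma optimised_parameters:
  assumes D: "D \<ge> 1 / 2" and \<delta>: "0 \<le> \<delta>" "\<delta> \<le> 1"
  defines "\<theta> \<equiv> \<delta> / (200 * (D\<^sup>2 * R))"
  shows "\<theta> \<ge> 0"
    and "\<bar>\<phi>\<bar> \<le> \<theta> + \<delta> * \<theta> / 10 \<Longrightarrow> 16 * \<phi>\<^sup>2 * D\<^sup>2 * R + 4 * (\<delta> * \<theta> / 10)\<^sup>2 * R \<le> \<delta> * \<theta> / 10"
proof -
  define u where "u = D\<^sup>2 * R"
  have u: "u > 0" using D R_pos by (auto simp: u_def)
  have \<theta>: "200 * u * \<theta> = \<delta>" using u by (simp add: \<theta>_def u_def[symmetric])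
  show \<theta>0: "\<theta> \<ge> 0" using u \<delta> by (simp add: \<theta>_def u_def[symmetric])
  assume "\<bar>\<phi>\<bar> \<le> \<theta> + \<delta> * \<theta> / 10"
  also have "\<dots> \<le> 11 / 10 * \<theta>" using mult_right_mono[OF \<delta>(2) \<theta>0] by simp
  finally have "\<bar>\<phi>\<bar>\<^sup>2 \<le> (11 / 10 * \<theta>)\<^sup>2" by (intro power_mono) auto
  hence "\<phi>\<^sup>2 * u \<le> (11 / 10 * \<theta>)\<^sup>2 * u" using u by (intro mult_right_mono) auto
  also have "\<dots> = 121 / 100 * \<theta> * (u * \<theta>)" by (simp add: power2_eq_square)
  also have "\<dots> = 121 / 20000 * (\<delta> * \<theta>)" using \<theta> by (simp add: mult_ac)
  finally have first: "\<phi>\<^sup>2 * u \<le> 121 / 20000 * (\<delta> * \<theta>)" .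
  \<comment> \<open>The lower bound on \<open>D\<close> makes \<open>R\<close> comparable with
    \<open>D\<^sup>2 * R\<close>, which bounds \<open>\<theta> * R\<close> and so keeps
    \<open>g\<^sup>2 * R\<close> small against \<open>g\<close>.\<close>
  have "1 / 4 * R \<le> u"
    unfolding u_def using R_pos power_mono[OF D, of 2] by (intro mult_right_mono) (auto simp: power2_eq_square)
  hence "\<theta> * R \<le> 4 * (u * \<theta>)" using mult_right_mono[OF _ \<theta>0, of "1 / 4 * R" u] by (simp add: mult_ac)
  also have "\<dots> = \<delta> / 50" using \<theta> by simp
  finally have "\<theta> * R \<le> 1 / 50" using \<delta> by simp
  have "(\<delta> * \<theta>) * (\<delta> * (\<theta> * R)) \<le> (\<delta> * \<theta>) * (1 * (1 / 50))"
    using \<delta> \<theta>0 R_pos \<open>\<theta> * R \<le> 1 / 50\<close> by (intro mult_left_mono mult_mono) auto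
  hence "(\<delta> * \<theta> / 10)\<^sup>2 * R \<le> (\<delta> * \<theta>) / 5000" by (simp add: power2_eq_square mult_ac)
  moreover have "16 * \<phi>\<^sup>2 * D\<^sup>2 * R = 16 * (\<phi>\<^sup>2 * u)" by (simp add: u_def)
  moreover have "\<delta> * \<theta> \<ge> 0" using \<delta> \<theta>0 by simp
  ultimately show "16 * \<phi>\<^sup>2 * D\<^sup>2 * R + 4 * (\<delta> * \<theta> / 10)\<^sup>2 * R \<le> \<delta> * \<theta> / 10"
    using first by linarith
qed

text \<open>With \<open>\<sigma> = 1\<close> this is the upper tail, and with \<open>\<sigma> = -1\<close> the lower tail.\<close>

lemma chernoff_tail:
  assumes total: "W {} = 1" and D: "D \<ge> 1 / 2" and \<delta>: "0 \<le> \<delta>" "\<delta> \<le> 1"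
    and \<sigma>: "\<sigma> = 1 \<or> \<sigma> = - 1" and m: "m \<ge> 0"
    and mean: "\<And>x. \<sigma> * qf d (mean_mat {}) x \<le> \<sigma> * m * sqn d x"
    and E: "E \<subseteq> Pow N"
      "\<And>S \<theta>. S \<in> E \<Longrightarrow> \<theta> \<ge> 0 \<Longrightarrow>
        exp (\<theta> * (\<sigma> * (1 + \<sigma> * \<delta>) * m)) \<le> trexp d (\<lambda>a c. (\<sigma> * \<theta>) * (\<Sum>i\<in>S. Y i a c))"
  shows "(\<Sum>S\<in>E. w S) \<le> real d * exp (- (\<delta>\<^sup>2 * m / (400 * R * D\<^sup>2)))"
proof -
  define \<theta> where "\<theta> = \<delta> / (200 * (D\<^sup>2 * R))"
  define g where "g = \<delta> * \<theta> / 10"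
  \<comment> \<open>Chosen so that \<open>\<phi> - g\<close>, the weight of the revealed part, is
    exactly the exponent \<open>\<sigma> * \<theta>\<close> tested on \<open>E\<close>.\<close>
  define \<phi> where "\<phi> = \<sigma> * \<theta> + g"
  note par = optimised_parameters[OF D \<delta>, folded \<theta>_def]
  have g0: "g \<ge> 0" using par(1) \<delta> by (simp add: g_def)
  have g1: "g \<le> \<theta>" using mult_right_mono[OF \<delta>(2) par(1)] par(1) by (simp add: g_def)
  have "\<bar>\<phi>\<bar> \<le> \<theta> + g" using \<sigma> par(1) g0 by (auto simp: \<phi>_def)
  hence g: "16 * \<phi>\<^sup>2 * D\<^sup>2 * R + 4 * g\<^sup>2 * R \<le> g" unfolding g_def by (rule par(2))
  define s where "s = \<theta> * (\<sigma> * (1 + \<sigma> * \<delta>) * m)"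
  have "(\<Sum>S\<in>E. w S) \<le> real d * exp (\<phi> * m - s)"
  proof (rule exponential_tail[OF total g0 g E(1)])
    fix S assume "S \<in> E"
    thus "exp s \<le> trexp d (\<lambda>a c. (\<phi> - g) * (\<Sum>i\<in>S. Y i a c))"
      using E(2)[OF _ par(1)] by (simp add: s_def \<phi>_def)
  next
    fix x
    have "\<phi> * qf d (mean_mat {}) x = (\<sigma> * \<phi>) * (\<sigma> * qf d (mean_mat {}) x)" using \<sigma> by auto
    \<comment> \<open>\<open>\<sigma> * \<phi>\<close> is \<open>\<theta> + g\<close> or
      \<open>\<theta> - g\<close>; \<open>g \<le> \<theta>\<close> keeps it nonnegative in the lower
      tail.\<close>
    also have "\<dots> \<le> (\<sigma> * \<phi>) * (\<sigma> * m * sqn d x)"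
      using \<sigma> par(1) g0 g1 by (intro mult_left_mono mean) (auto simp: \<phi>_def)
    also have "\<dots> = \<phi> * m * sqn d x" using \<sigma> by auto
    finally show "\<phi> * qf d (mean_mat {}) x \<le> \<phi> * m * sqn d x" .
  qed
  \<comment> \<open>The correction \<open>g\<close> spends one tenth of the gain
    \<open>\<delta> * \<theta> * m\<close>. The remaining 9/10 is rounded down to 1/2, which turns
    200 into the final constant 400.\<close>
  also have "\<phi> * m - s = - (9 / 10 * (\<delta> * \<theta> * m))"
    using \<sigma> by (auto simp: \<phi>_def s_def g_def algebra_simps)
  also have "- (9 / 10 * (\<delta> * \<theta> * m)) \<le> - (1 / 2 * (\<delta> * \<theta> * m))"
    using \<delta> par(1) m by simp
  also have "1 / 2 * (\<delta> * \<theta> * m) = \<delta>\<^sup>2 * m / (400 * R * D\<^sup>2)"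
    by (simp add: \<theta>_def power2_eq_square mult_ac)
  finally show ?thesis by (simp add: mult_left_mono)
qed

end

section \<open>Eigenvalues of matrices\<close>

definition entries :: "real mat \<Rightarrow> nat \<Rightarrow> nat \<Rightarrow> real" where
  "entries A = (\<lambda>a b. A $$ (a, b))"

lemma symmetric_entries: "symmetric_real_mat d A \<Longrightarrow> symmetric_below d (entries A)"
  unfolding symmetric_real_mat_def symmetric_below_def entries_def
  by (metis carrier_matD index_transpose_mat(1))

lemma mult_mat_vec_entries:
  assumes "A \<in> carrier_mat d d" "v \<in> carrier_vec d" "a < d"
  shows "vec_index (A *\<^sub>v v) a = mv d (entries A) (vec_index v) a"
  using assms by (simp add: mv_def entries_def scalar_prod_def lessThan_atLeast0)

lemma scalar_prod_ip:
  "v \<in> carrier_vec d \<Longrightarrow> scalar_prod u v = ip d (vec_index u) (vec_index v)"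
  by (simp add: ip_def scalar_prod_def lessThan_atLeast0)

text \<open>An eigenvector overlaps some \<open>U j\<close> by Parseval, and moving the matrix
  across the inner product identifies its eigenvalue with \<open>b j\<close>.\<close>

lemma spectrum_eigensystem:
  assumes A: "A \<in> carrier_mat d d" and sym: "symmetric_below d (entries A)"
    and E: "eigensystem d d (entries A) b U"
  shows "spectrum A = b ` {..<d}"
proof (intro subset_antisym subsetI)
  note on = eigensystem_orthonormal[OF E]
  fix k assume "k \<in> spectrum A"
  then obtain v where v: "v \<in> carrier_vec d" "v \<noteq> 0\<^sub>v d" "A *\<^sub>v v = k \<cdot>\<^sub>v v"
    using A by (auto simp: spectrum_def eigenvalue_def eigenvector_def)
  define x where "x = (vec_index v)"
  have Ax: "mv d (entries A) x a = k * x a" if "a < d" for a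
    using mult_mat_vec_entries[OF A v(1) that] v that by (simp add: x_def)
  have "\<exists>j<d. ip d (U j) x \<noteq> 0"
  proof (rule ccontr)
    assume "\<not> ?thesis"
    hence "sqn d x = 0" using parseval_norm[OF on, of x] by simp
    hence "v = 0\<^sub>v d" using v(1) ip_self_eq_0[of d x] by (intro eq_vecI) (auto simp: x_def)
    thus False using v(2) by contradiction
  qed
  then obtain j where j: "j < d" "ip d (U j) x \<noteq> 0" by blast
  have "b j * ip d (U j) x = ip d (U j) (mv d (entries A) x)"
    by (rule ip_eigenvector_mv[OF sym E j(1), symmetric])
  also have "\<dots> = k * ip d (U j) x"
    by (subst ip_scale_right[symmetric], rule ip_cong) (simp_all add: Ax)
  finally show "k \<in> b ` {..<d}" using j by auto
next
  note on = eigensystem_orthonormal[OF E]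
  fix k assume "k \<in> b ` {..<d}"
  then obtain j where j: "j < d" "k = b j" by blast
  define v where "v = Matrix.vec d (U j)"
  have v: "v \<in> carrier_vec d" by (simp add: v_def)
  have eq: "mv d (entries A) (vec_index v) = mv d (entries A) (U j)"
    by (rule mv_cong) (simp add: v_def)
  have "A *\<^sub>v v = k \<cdot>\<^sub>v v"
  proof (rule eq_vecI)
    fix a assume "a < dim_vec (k \<cdot>\<^sub>v v)"
    hence a: "a < d" by (simp add: v_def)
    show "vec_index (A *\<^sub>v v) a = vec_index (k \<cdot>\<^sub>v v) a"
      using mult_mat_vec_entries[OF A v a, unfolded eq] E j a by (simp add: eigensystem_def v_def)
  qed (use A in \<open>simp add: v_def\<close>)
  moreover have "v \<noteq> 0\<^sub>v d"
  proof
    assume "v = 0\<^sub>v d"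
    hence "U j a = 0" if "a < d" for a using that by (metis index_vec index_zero_vec(1) v_def)
    hence "ip d (U j) (U j) = 0" by (simp add: ip_def)
    thus False using orthonormal_self[OF on j(1)] by simp
  qed
  ultimately show "k \<in> spectrum A"
    using v A by (auto simp: spectrum_def eigenvalue_def eigenvector_def)
qed

context
  fixes d :: nat and A :: "real mat"
  assumes d: "d \<ge> 1" and A: "symmetric_real_mat d A"
begin

lemma carrier_sym: "A \<in> carrier_mat d d"
  using A by (simp add: symmetric_real_mat_def)

lemma finite_nonempty_spectrum: "finite (spectrum A)" "spectrum A \<noteq> {}"
proof -
  obtain b U where "eigensystem d d (entries A) b U"
    using spectral_theorem[OF symmetric_entries[OF A]] .
  hence "spectrum A = b ` {..<d}" by (rule spectrum_eigensystem[OF carrier_sym symmetric_entries[OF A]])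
  thus "finite (spectrum A)" "spectrum A \<noteq> {}" using d by (auto simp: lessThan_empty_iff)
qed

lemma lambda_in_spectrum: "lambda_min A \<in> spectrum A" "lambda_max A \<in> spectrum A"
  unfolding lambda_min_def lambda_max_def
  by (intro Min_in Max_in finite_nonempty_spectrum)+

lemma qf_lambda_bounds:
  "lambda_min A * sqn d x \<le> qf d (entries A) x"
  "qf d (entries A) x \<le> lambda_max A * sqn d x"
proof -
  note sym = symmetric_entries[OF A]
  obtain b U where E: "eigensystem d d (entries A) b U" using spectral_theorem[OF sym] .
  note on = eigensystem_orthonormal[OF E]
  have "lambda_min A \<le> b j" "b j \<le> lambda_max A" if "j < d" for j
    using that finite_nonempty_spectrum spectrum_eigensystem[OF carrier_sym sym E]
    by (auto simp: lambda_min_def lambda_max_def)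
  thus "lambda_min A * sqn d x \<le> qf d (entries A) x" "qf d (entries A) x \<le> lambda_max A * sqn d x"
    unfolding qf_eigensystem[OF sym E] parseval_norm[OF on, symmetric] sum_distrib_left
    by (auto intro!: sum_mono mult_right_mono)
qed

text \<open>A single term of a sum of positive terms. A negative \<open>\<theta>\<close> is allowed:
  it is how the lower tail sees the smallest eigenvalue.\<close>

lemma exp_le_trexp:
  assumes "l \<in> spectrum A"
  shows "exp (\<theta> * l) \<le> trexp d (\<lambda>a c. \<theta> * entries A a c)"
proof -
  note sym = symmetric_entries[OF A]
  obtain b U where E: "eigensystem d d (entries A) b U" using spectral_theorem[OF sym] .
  have "eigensystem d d (\<lambda>a c. \<theta> * entries A a c) (\<lambda>j. \<theta> * b j) U"
    using E by (simp add: eigensystem_def mv_mat_linear)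
  hence tr: "trexp d (\<lambda>a c. \<theta> * entries A a c) = (\<Sum>j<d. exp (\<theta> * b j))"
    by (rule trexp_eigensystem[OF symmetric_below_scale[OF sym]])
  obtain j where "j < d" "l = b j" using assms spectrum_eigensystem[OF carrier_sym sym E] by auto
  thus ?thesis unfolding tr by (auto intro!: member_le_sum)
qed

lemma lambda_nonneg:
  assumes "\<And>x. qf d (entries A) x \<ge> 0"
  shows "lambda_min A \<ge> 0" "lambda_max A \<ge> 0"
proof -
  note sym = symmetric_entries[OF A]
  obtain b U where E: "eigensystem d d (entries A) b U" using spectral_theorem[OF sym] .
  have "l \<ge> 0" if "l \<in> spectrum A" for l
    using that spectrum_eigensystem[OF carrier_sym sym E] eigenvalue_qf[OF E] assms by auto
  thus "lambda_min A \<ge> 0" "lambda_max A \<ge> 0" using lambda_in_spectrum by auto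
qed

end

lemma psd_mat_qf:
  assumes "psd_mat d A"
  shows "qf d (entries A) x \<ge> 0"
proof -
  have A: "A \<in> carrier_mat d d" using assms by (simp add: psd_mat_def symmetric_real_mat_def)
  define v where "v = Matrix.vec d x"
  have v: "v \<in> carrier_vec d" by (simp add: v_def)
  have "0 \<le> scalar_prod v (A *\<^sub>v v)" using assms v by (simp add: psd_mat_def)
  also have "\<dots> = ip d (vec_index v) (vec_index (A *\<^sub>v v))"
    using A v by (intro scalar_prod_ip) auto
  also have "\<dots> = qf d (entries A) x"
  proof (rule ip_cong)
    fix a assume a: "a < d"
    show "vec_index v a = x a" using a by (simp add: v_def)
    have "mv d (entries A) (vec_index v) = mv d (entries A) x" by (rule mv_cong) (simp add: v_def)
    thus "vec_index (A *\<^sub>v v) a = mv d (entries A) x a" using mult_mat_vec_entries[OF A v a] by simp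
  qed
  finally show ?thesis .
qed

lemma loewner_le_qf:
  assumes "loewner_le d A B"
  shows "qf d (entries A) x \<le> qf d (entries B) x"
proof -
  have c: "A \<in> carrier_mat d d" "B \<in> carrier_mat d d"
    using assms by (auto simp: loewner_le_def symmetric_real_mat_def)
  have "0 \<le> qf d (entries (B - A)) x" using assms by (simp add: loewner_le_def psd_mat_qf)
  also have "\<dots> = ip d x (\<lambda>a. mv d (entries B) x a - mv d (entries A) x a)"
    using c by (intro ip_cong refl)
      (auto simp: mv_def entries_def left_diff_distrib sum_subtractf[symmetric] intro!: sum.cong)
  finally show ?thesis by (simp add: ip_linear)
qed

section \<open>Distributions on the cube\<close>

declare One_nat_def [simp del]

lemma mv_mat_cong:
  "(\<And>a b. a < d \<Longrightarrow> b < d \<Longrightarrow> A a b = B a b) \<Longrightarrow> a < d \<Longrightarrow> mv d A x a = mv d B x a"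
  by (simp add: mv_def)

lemma qf_mat_cong:
  "(\<And>a b. a < d \<Longrightarrow> b < d \<Longrightarrow> A a b = B a b) \<Longrightarrow> qf d A x = qf d B x"
  by (intro ip_cong refl mv_mat_cong)

text \<open>Entries of a \<open>Matrix.mat\<close> outside its dimensions are unspecified, so
  matrices built in different ways agree only below \<open>d\<close>. The choices made by
  \<open>SOME\<close> coincide because the predicates do.\<close>

lemma trexp_cong:
  assumes "\<And>a b. a < d \<Longrightarrow> b < d \<Longrightarrow> A a b = B a b"
  shows "trexp d A = trexp d B"
proof -
  have "eigensystem d d A b U = eigensystem d d B b U" for b U
    unfolding eigensystem_def using mv_mat_cong[of d A B, OF assms] by simp
  thus ?thesis by (simp add: trexp_def)
qed

definition ones :: "nat \<Rightarrow> (nat \<Rightarrow> real) \<Rightarrow> nat set" where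
  "ones n \<xi> = {i \<in> {1..n}. \<xi> i = 1}"

definition subset_sum_mat :: "nat \<Rightarrow> (nat \<Rightarrow> real mat) \<Rightarrow> nat set \<Rightarrow> real mat" where
  "subset_sum_mat d Y S = Matrix.mat d d (\<lambda>(a, b). \<Sum>i\<in>S. Y i $$ (a, b))"

lemma symmetric_subset_sum_mat:
  assumes "\<And>i. i \<in> S \<Longrightarrow> symmetric_real_mat d (Y i)"
  shows "symmetric_real_mat d (subset_sum_mat d Y S)"
proof -
  have "Y i $$ (a, b) = Y i $$ (b, a)" if "i \<in> S" "a < d" "b < d" for i a b
    using symmetric_entries[OF assms[OF that(1)]] that by (simp add: symmetric_below_def entries_def)
  thus ?thesis
    by (auto simp: symmetric_real_mat_def subset_sum_mat_def intro!: eq_matI sum.cong)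
qed

lemma trexp_subset_sum_mat:
  "trexp d (\<lambda>a c. \<theta> * (\<Sum>i\<in>S. entries (Y i) a c)) =
   trexp d (\<lambda>a c. \<theta> * entries (subset_sum_mat d Y S) a c)"
  by (rule trexp_cong) (simp add: entries_def subset_sum_mat_def)

section \<open>From distributions on the cube to weights on sets\<close>

context
  fixes n k :: nat and \<mu> :: "(nat \<Rightarrow> real) pmf"
  assumes dist: "distribution_on_cube n \<mu>" and hom: "homogeneous n k \<mu>"
begin

lemma coordinate_cases: "\<xi> \<in> set_pmf \<mu> \<Longrightarrow> i \<in> {1..n} \<Longrightarrow> \<xi> i = 0 \<or> \<xi> i = 1"
  using dist PiE_mem by (fastforce simp: distribution_on_cube_def cube_def)

lemma finite_set_pmf_cube: "finite (set_pmf \<mu>)"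
  using dist unfolding distribution_on_cube_def cube_def
  by (rule finite_subset) (intro finite_PiE, auto)

lemma ones_inj: "\<xi> \<in> set_pmf \<mu> \<Longrightarrow> \<eta> \<in> set_pmf \<mu> \<Longrightarrow> ones n \<xi> = ones n \<eta> \<Longrightarrow> \<xi> = \<eta>"
proof (rule PiE_ext[of \<xi> "{1..n}" "\<lambda>_. {0, 1}" \<eta>])
  fix i assume *: "\<xi> \<in> set_pmf \<mu>" "\<eta> \<in> set_pmf \<mu>" "ones n \<xi> = ones n \<eta>" "i \<in> {1..n}"
  hence "\<xi> i = 1 \<longleftrightarrow> \<eta> i = 1" by (auto simp: ones_def)
  thus "\<xi> i = \<eta> i" using coordinate_cases[of \<xi> i] coordinate_cases[of \<eta> i] * by auto
qed (use dist in \<open>auto simp: distribution_on_cube_def cube_def\<close>)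

lemma card_ones: "\<xi> \<in> set_pmf \<mu> \<Longrightarrow> card (ones n \<xi>) = k"
proof -
  assume \<xi>: "\<xi> \<in> set_pmf \<mu>"
  hence "real k = (\<Sum>i = 1..n. \<bar>\<xi> i\<bar>)"
    using hom by (simp add: homogeneous_def AE_measure_pmf_iff)
  also have "\<dots> = (\<Sum>i = 1..n. if \<xi> i = 1 then 1 else 0)"
    using coordinate_cases[OF \<xi>] by (intro sum.cong) force+
  also have "\<dots> = real (card (ones n \<xi>))"
    by (simp add: ones_def sum.inter_filter[symmetric])
  finally show ?thesis by simp
qed

lemma prob_ones:
  "measure_pmf.prob \<mu> {\<xi>. Q (ones n \<xi>)} = (\<Sum>S\<in>{S \<in> Pow {1..n}. Q S}. pmf (map_pmf (ones n) \<mu>) S)"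
proof -
  have "measure_pmf.prob \<mu> {\<xi>. Q (ones n \<xi>)} = measure_pmf.prob (map_pmf (ones n) \<mu>) {S. Q S}"
    by (simp add: vimage_def)
  also have "\<dots> = measure_pmf.prob (map_pmf (ones n) \<mu>) {S \<in> Pow {1..n}. Q S}"
    by (rule measure_prob_cong_0) (auto simp: pmf_eq_0_set_pmf ones_def)
  also have "\<dots> = (\<Sum>S\<in>{S \<in> Pow {1..n}. Q S}. pmf (map_pmf (ones n) \<mu>) S)"
    by (rule measure_measure_pmf_finite) auto
  finally show ?thesis .
qed

lemma homogeneous_weight_ones: "homogeneous_weight {1..n} (pmf (map_pmf (ones n) \<mu>)) k"
  by unfold_locales (auto simp: pmf_eq_0_set_pmf card_ones)

interpretation hw: homogeneous_weight "{1..n}" "pmf (map_pmf (ones n) \<mu>)" k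
  by (rule homogeneous_weight_ones)

lemma W_prob:
  assumes "L \<subseteq> {1..n}"
  shows "hw.W L = measure_pmf.prob \<mu> {\<xi>. \<forall>l\<in>L. \<xi> l = 1}"
proof -
  have "hw.W L = measure_pmf.prob \<mu> {\<xi>. L \<subseteq> ones n \<xi>}"
    unfolding prob_ones hw.W_def hw.supersets_def by (intro sum.cong) auto
  also have "{\<xi>. L \<subseteq> ones n \<xi>} = {\<xi>. \<forall>l\<in>L. \<xi> l = 1}"
    using assms by (auto simp: ones_def)
  finally show ?thesis .
qed

lemma independent_ones:
  assumes "linf_independent n \<mu> D"
  shows "hw.independent D"
  unfolding hw.independent_def
proof (intro allI impI ballI)
  fix L i assume L: "L \<subseteq> {1..n}" and i: "i \<in> {1..n} - L"
  define N where "N = {1..n} - L"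
  have "(\<Sum>j\<in>N. \<bar>influence_matrix \<mu> L i j\<bar>) \<le> infty_norm N (influence_matrix \<mu> L)"
    using i unfolding infty_norm_def by (auto intro!: Max_ge simp: N_def)
  also have "\<dots> \<le> D" using assms L by (simp add: linf_independent_def N_def)
  also have "(\<Sum>j\<in>N. \<bar>influence_matrix \<mu> L i j\<bar>) = (\<Sum>j\<in>N. if hw.W (insert j (insert i L)) > 0
     then \<bar>hw.W (insert j (insert i L)) / hw.W (insert i L) - hw.W (insert j L) / hw.W L\<bar> else 0)"
  proof (intro sum.cong refl)
    fix j assume "j \<in> N"
    hence "j \<in> {1..n}" "i \<in> {1..n}" using i by (auto simp: N_def)
    hence sub: "insert j (insert i L) \<subseteq> {1..n}" "insert i L \<subseteq> {1..n}" "insert j L \<subseteq> {1..n}"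
      using L by auto
    have ij: "L \<union> {i, j} = insert j (insert i L)" by auto
    show "\<bar>influence_matrix \<mu> L i j\<bar> = (if hw.W (insert j (insert i L)) > 0
     then \<bar>hw.W (insert j (insert i L)) / hw.W (insert i L) - hw.W (insert j L) / hw.W L\<bar> else 0)"
      unfolding influence_matrix_def one_sided_influence_def cond_prob_def ij
        W_prob[OF sub(1)] W_prob[OF sub(2)] W_prob[OF sub(3)] W_prob[OF L]
      by simp
  qed
  finally show "(\<Sum>j\<in>{1..n}-L. if hw.W (insert j (insert i L)) > 0
     then \<bar>hw.W (insert j (insert i L)) / hw.W (insert i L) - hw.W (insert j L) / hw.W L\<bar> else 0) \<le> D"
    by (simp only: N_def)
qed

lemma random_mat_sum_eq:
  assumes Y: "\<And>i. i \<in> {1..n} \<Longrightarrow> Y i \<in> carrier_mat d d" and \<xi>: "\<xi> \<in> set_pmf \<mu>"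
  shows "random_mat_sum n d Y \<xi> = subset_sum_mat d Y (ones n \<xi>)"
proof (rule eq_matI)
  fix a b assume "a < dim_row (subset_sum_mat d Y (ones n \<xi>))" "b < dim_col (subset_sum_mat d Y (ones n \<xi>))"
  hence ab: "a < d" "b < d" by (auto simp: subset_sum_mat_def)
  have "(\<xi> i \<cdot>\<^sub>m Y i) $$ (a, b) = (if \<xi> i = 1 then Y i $$ (a, b) else 0)" if "i \<in> {1..n}" for i
    using coordinate_cases[OF \<xi> that] Y[OF that] ab by auto
  hence "(\<Sum>i = 1..n. (\<xi> i \<cdot>\<^sub>m Y i) $$ (a, b)) = (\<Sum>i = 1..n. if \<xi> i = 1 then Y i $$ (a, b) else 0)"
    by (intro sum.cong refl)
  also have "\<dots> = (\<Sum>i\<in>ones n \<xi>. Y i $$ (a, b))" by (simp add: ones_def sum.inter_filter[symmetric])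
  finally show "random_mat_sum n d Y \<xi> $$ (a, b) = subset_sum_mat d Y (ones n \<xi>) $$ (a, b)"
    using ab by (simp add: random_mat_sum_def mat_sum_def subset_sum_mat_def)
qed (auto simp: random_mat_sum_def mat_sum_def subset_sum_mat_def)

lemma prob_random_mat_sum:
  assumes Y: "\<And>i. i \<in> {1..n} \<Longrightarrow> Y i \<in> carrier_mat d d"
  shows "\<P>(\<xi> in measure_pmf \<mu>. Q (random_mat_sum n d Y \<xi>)) =
    (\<Sum>S\<in>{S \<in> Pow {1..n}. Q (subset_sum_mat d Y S)}. pmf (map_pmf (ones n) \<mu>) S)"
proof -
  have "measure_pmf.prob \<mu> {\<xi>. Q (random_mat_sum n d Y \<xi>)} =
        measure_pmf.prob \<mu> {\<xi>. Q (subset_sum_mat d Y (ones n \<xi>))}"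
  proof (rule measure_prob_cong_0)
    have "random_mat_sum n d Y \<xi> = subset_sum_mat d Y (ones n \<xi>)" if "\<xi> \<in> set_pmf \<mu>" for \<xi>
      by (rule random_mat_sum_eq[OF Y that])
    thus "\<And>\<xi>. \<xi> \<in> {\<xi>. Q (random_mat_sum n d Y \<xi>)} - {\<xi>. Q (subset_sum_mat d Y (ones n \<xi>))} \<Longrightarrow> pmf \<mu> \<xi> = 0"
      and "\<And>\<xi>. \<xi> \<in> {\<xi>. Q (subset_sum_mat d Y (ones n \<xi>))} - {\<xi>. Q (random_mat_sum n d Y \<xi>)} \<Longrightarrow> pmf \<mu> \<xi> = 0"
      by (auto simp: pmf_eq_0_set_pmf)
  qed
  thus ?thesis using prob_ones[of "\<lambda>S. Q (subset_sum_mat d Y S)"] by simp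
qed

lemma expectation_coordinate:
  assumes "i \<in> {1..n}"
  shows "measure_pmf.expectation \<mu> (\<lambda>\<xi>. \<xi> i) = hw.W {i}"
proof -
  have "measure_pmf.expectation \<mu> (\<lambda>\<xi>. \<xi> i) = measure_pmf.expectation \<mu> (indicator {\<xi>. \<xi> i = 1})"
    using coordinate_cases assms
    by (intro integral_cong_AE) (auto simp: AE_measure_pmf_iff indicator_def)
  also have "\<dots> = hw.W {i}" using assms by (simp add: W_prob)
  finally show ?thesis .
qed

lemma mat_expectation_entry:
  assumes Y: "\<And>i. i \<in> {1..n} \<Longrightarrow> Y i \<in> carrier_mat d d" and ab: "a < d" "b < d"
  shows "mat_expectation d \<mu> (random_mat_sum n d Y) $$ (a, b) = (\<Sum>i\<in>{1..n}. hw.W {i} * Y i $$ (a, b))"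
proof -
  have "(\<xi> i \<cdot>\<^sub>m Y i) $$ (a, b) = \<xi> i * Y i $$ (a, b)" if "i \<in> {1..n}" for \<xi> i
    using Y[OF that] ab by auto
  hence "mat_expectation d \<mu> (random_mat_sum n d Y) $$ (a, b) =
      measure_pmf.expectation \<mu> (\<lambda>\<xi>. \<Sum>i = 1..n. \<xi> i * Y i $$ (a, b))"
    using ab by (simp add: mat_expectation_def random_mat_sum_def mat_sum_def)
  also have "\<dots> = (\<Sum>i = 1..n. measure_pmf.expectation \<mu> (\<lambda>\<xi>. \<xi> i * Y i $$ (a, b)))"
    by (intro Bochner_Integration.integral_sum integrable_measure_pmf_finite finite_set_pmf_cube)
  also have "\<dots> = (\<Sum>i = 1..n. hw.W {i} * Y i $$ (a, b))"
    by (intro sum.cong refl) (simp add: expectation_coordinate)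
  finally show ?thesis .
qed

lemma W_empty_eq_1: "hw.W {} = 1"
  by (simp add: W_prob)

lemma deterministic:
  assumes "linf_independent n \<mu> D" "D < 1 / 2"
  obtains \<xi> where "\<mu> = return_pmf \<xi>"
proof -
  obtain \<xi> where \<xi>: "\<xi> \<in> set_pmf \<mu>" using set_pmf_not_empty[of \<mu>] by blast
  have "\<eta> = \<xi>" if \<eta>: "\<eta> \<in> set_pmf \<mu>" for \<eta>
  proof (rule ones_inj[OF \<eta> \<xi>], rule hw.support_unique[OF independent_ones[OF assms(1)] assms(2)])
    show "ones n \<eta> \<subseteq> {1..n}" "ones n \<xi> \<subseteq> {1..n}" by (auto simp: ones_def)
    show "pmf (map_pmf (ones n) \<mu>) (ones n \<eta>) \<noteq> 0" "pmf (map_pmf (ones n) \<mu>) (ones n \<xi>) \<noteq> 0"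
      using \<eta> \<xi> by (auto simp: pmf_eq_0_set_pmf)
  qed
  hence "\<mu> = return_pmf \<xi>" by (auto simp: set_pmf_subset_singleton[symmetric])
  thus ?thesis using that by blast
qed

section \<open>The two tails for a fixed family of matrices\<close>

context
  fixes d :: nat and D R :: real and Y :: "nat \<Rightarrow> real mat"
  assumes d: "d \<ge> 1" and ind: "linf_independent n \<mu> D" and R: "R > 0"
    and Y: "\<And>i. i \<in> {1..n} \<Longrightarrow> symmetric_real_mat d (Y i)"
      "\<And>i. i \<in> {1..n} \<Longrightarrow> loewner_le d (0\<^sub>m d d) (Y i)"
      "\<And>i. i \<in> {1..n} \<Longrightarrow> loewner_le d (Y i) (R \<cdot>\<^sub>m 1\<^sub>m d)"
begin

lemma Y_carrier: "i \<in> {1..n} \<Longrightarrow> Y i \<in> carrier_mat d d"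
  using Y(1) by (simp add: symmetric_real_mat_def)

lemma qf_Y_bounds:
  assumes "i \<in> {1..n}"
  shows "0 \<le> qf d (entries (Y i)) x" "qf d (entries (Y i)) x \<le> R * sqn d x"
proof -
  have "qf d (entries (0\<^sub>m d d)) x = 0" by (simp add: entries_def mv_def ip_def)
  thus "0 \<le> qf d (entries (Y i)) x" using loewner_le_qf[OF Y(2)[OF assms], of x] by simp
  have "qf d (entries (R \<cdot>\<^sub>m 1\<^sub>m d)) x = ip d x (\<lambda>a. R * x a)"
  proof (rule ip_cong)
    fix a assume a: "a < d"
    have "mv d (entries (R \<cdot>\<^sub>m 1\<^sub>m d)) x a = (\<Sum>b<d. if a = b then R * x b else 0)"
      unfolding mv_def entries_def using a by (intro sum.cong) auto
    thus "mv d (entries (R \<cdot>\<^sub>m 1\<^sub>m d)) x a = R * x a" using a by simp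
  qed simp
  thus "qf d (entries (Y i)) x \<le> R * sqn d x"
    using loewner_le_qf[OF Y(3)[OF assms], of x] by (simp add: ip_linear)
qed

interpretation mf: matrix_family "{1..n}" "pmf (map_pmf (ones n) \<mu>)" k d "\<lambda>i. entries (Y i)" R D
  by unfold_locales (rule symmetric_entries Y(1) qf_Y_bounds R independent_ones[OF ind] | assumption)+

abbreviation (input) mean :: "real mat" where
  "mean \<equiv> mat_expectation d \<mu> (random_mat_sum n d Y)"

lemma mean_entries: "a < d \<Longrightarrow> b < d \<Longrightarrow> entries mean a b = mf.mean_mat {} a b"
  unfolding mf.mean_mat_def using mat_expectation_entry[of Y d, OF Y_carrier]
  by (simp add: entries_def W_empty_eq_1)

lemma symmetric_mean: "symmetric_real_mat d mean"
proof -
  have "mean \<in> carrier_mat d d" by (simp add: mat_expectation_def)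
  moreover have "mean $$ (a, b) = mean $$ (b, a)" if "a < d" "b < d" for a b
  proof -
    have "Y i $$ (a, b) = Y i $$ (b, a)" if "i \<in> {1..n}" for i
      using symmetric_entries[OF Y(1)[OF that]] \<open>a < d\<close> \<open>b < d\<close> by (auto simp: entries_def symmetric_below_def)
    hence "mf.mean_mat {} a b = mf.mean_mat {} b a"
      unfolding mf.mean_mat_def by (intro sum.cong) (auto simp: entries_def)
    thus ?thesis using that mean_entries[of a b] mean_entries[of b a] by (simp add: entries_def)
  qed
  ultimately show ?thesis by (auto simp: symmetric_real_mat_def intro!: eq_matI)
qed

lemma qf_mean: "qf d (entries mean) x = qf d (mf.mean_mat {}) x"
  by (intro qf_mat_cong mean_entries)

lemma qf_mean_nonneg: "qf d (entries mean) x \<ge> 0"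
  unfolding qf_mean mf.mean_mat_def
  by (auto simp: W_empty_eq_1 mv_mat_sum mv_mat_linear ip_linear hw.W_nonneg intro!: sum_nonneg mult_nonneg_nonneg qf_Y_bounds)

lemma lower_tail:
  assumes D: "D \<ge> 1 / 2" and \<delta>: "\<delta> \<in> {0..1}"
  shows "\<P>(\<xi> in measure_pmf \<mu>. lambda_min (random_mat_sum n d Y \<xi>) \<le> (1 - \<delta>) * lambda_min mean)
    \<le> real d * exp (- (\<delta>\<^sup>2 * lambda_min mean / (400 * R * D\<^sup>2)))"
proof -
  define E where "E = {S \<in> Pow {1..n}. lambda_min (subset_sum_mat d Y S) \<le> (1 - \<delta>) * lambda_min mean}"
  have "exp (\<theta> * (- 1 * (1 + - 1 * \<delta>) * lambda_min mean))
      \<le> trexp d (\<lambda>a c. (- 1 * \<theta>) * (\<Sum>i\<in>S. entries (Y i) a c))"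
    if S: "S \<in> E" and \<theta>: "0 \<le> \<theta>" for S \<theta>
  proof -
    have sym: "symmetric_real_mat d (subset_sum_mat d Y S)"
      using S by (intro symmetric_subset_sum_mat Y) (auto simp: E_def)
    have "exp (\<theta> * (- 1 * (1 + - 1 * \<delta>) * lambda_min mean)) \<le> exp ((- 1 * \<theta>) * lambda_min (subset_sum_mat d Y S))"
      using mult_left_mono[of "lambda_min (subset_sum_mat d Y S)" "(1 - \<delta>) * lambda_min mean" \<theta>] S \<theta>
      by (simp add: E_def algebra_simps)
    also have "\<dots> \<le> trexp d (\<lambda>a c. (- 1 * \<theta>) * (\<Sum>i\<in>S. entries (Y i) a c))"
      unfolding trexp_subset_sum_mat by (intro exp_le_trexp[OF d sym] lambda_in_spectrum[OF d sym])
    finally show ?thesis .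
  qed
  moreover have "- 1 * qf d (mf.mean_mat {}) x \<le> - 1 * lambda_min mean * sqn d x" for x
    using qf_lambda_bounds(1)[OF d symmetric_mean, of x] by (simp add: qf_mean)
  moreover have "lambda_min mean \<ge> 0" by (rule lambda_nonneg(1)[OF d symmetric_mean qf_mean_nonneg])
  ultimately have "(\<Sum>S\<in>E. pmf (map_pmf (ones n) \<mu>) S) \<le> real d * exp (- (\<delta>\<^sup>2 * lambda_min mean / (400 * R * D\<^sup>2)))"
    using D \<delta> W_empty_eq_1 by (intro mf.chernoff_tail[where \<sigma> = "- 1"]) (auto simp: E_def)
  also have "(\<Sum>S\<in>E. pmf (map_pmf (ones n) \<mu>) S) =
      \<P>(\<xi> in measure_pmf \<mu>. lambda_min (random_mat_sum n d Y \<xi>) \<le> (1 - \<delta>) * lambda_min mean)"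
    unfolding E_def by (rule prob_random_mat_sum[of Y d "\<lambda>A. lambda_min A \<le> (1 - \<delta>) * lambda_min mean", symmetric]) (rule Y_carrier)
  finally show ?thesis .
qed

lemma upper_tail:
  assumes D: "D \<ge> 1 / 2" and \<delta>: "\<delta> \<in> {0..1}"
  shows "\<P>(\<xi> in measure_pmf \<mu>. lambda_max (random_mat_sum n d Y \<xi>) \<ge> (1 + \<delta>) * lambda_max mean)
    \<le> real d * exp (- (\<delta>\<^sup>2 * lambda_max mean / (400 * R * D\<^sup>2)))"
proof -
  define E where "E = {S \<in> Pow {1..n}. lambda_max (subset_sum_mat d Y S) \<ge> (1 + \<delta>) * lambda_max mean}"
  have "exp (\<theta> * (1 * (1 + 1 * \<delta>) * lambda_max mean))
      \<le> trexp d (\<lambda>a c. (1 * \<theta>) * (\<Sum>i\<in>S. entries (Y i) a c))"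
    if S: "S \<in> E" and \<theta>: "0 \<le> \<theta>" for S \<theta>
  proof -
    have sym: "symmetric_real_mat d (subset_sum_mat d Y S)"
      using S by (intro symmetric_subset_sum_mat Y) (auto simp: E_def)
    have "exp (\<theta> * (1 * (1 + 1 * \<delta>) * lambda_max mean)) \<le> exp ((1 * \<theta>) * lambda_max (subset_sum_mat d Y S))"
      using mult_left_mono[of "(1 + \<delta>) * lambda_max mean" "lambda_max (subset_sum_mat d Y S)" \<theta>] S \<theta>
      by (simp add: E_def)
    also have "\<dots> \<le> trexp d (\<lambda>a c. (1 * \<theta>) * (\<Sum>i\<in>S. entries (Y i) a c))"
      unfolding trexp_subset_sum_mat by (intro exp_le_trexp[OF d sym] lambda_in_spectrum[OF d sym])
    finally show ?thesis .
  qed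
  moreover have "1 * qf d (mf.mean_mat {}) x \<le> 1 * lambda_max mean * sqn d x" for x
    using qf_lambda_bounds(2)[OF d symmetric_mean, of x] by (simp add: qf_mean)
  moreover have "lambda_max mean \<ge> 0" by (rule lambda_nonneg(2)[OF d symmetric_mean qf_mean_nonneg])
  ultimately have "(\<Sum>S\<in>E. pmf (map_pmf (ones n) \<mu>) S) \<le> real d * exp (- (\<delta>\<^sup>2 * lambda_max mean / (400 * R * D\<^sup>2)))"
    using D \<delta> W_empty_eq_1 by (intro mf.chernoff_tail[where \<sigma> = 1]) (auto simp: E_def)
  also have "(\<Sum>S\<in>E. pmf (map_pmf (ones n) \<mu>) S) =
      \<P>(\<xi> in measure_pmf \<mu>. lambda_max (random_mat_sum n d Y \<xi>) \<ge> (1 + \<delta>) * lambda_max mean)"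
    unfolding E_def by (rule prob_random_mat_sum[of Y d "\<lambda>A. lambda_max A \<ge> (1 + \<delta>) * lambda_max mean", symmetric]) (rule Y_carrier)
  finally show ?thesis .
qed

text \<open>If \<open>\<delta> = 0\<close> or the eigenvalue of the mean vanishes, the right-hand side is at least 1.\<close>

lemma deterministic_tail:
  assumes D: "D < 1 / 2" and \<delta>: "\<delta> \<in> {0..1}"
  shows "\<P>(\<xi> in measure_pmf \<mu>. lambda_min (random_mat_sum n d Y \<xi>) \<le> (1 - \<delta>) * lambda_min mean)
      \<le> real d * exp (- (\<delta>\<^sup>2 * lambda_min mean / (400 * R * D\<^sup>2)))" (is ?lower)
    and "\<P>(\<xi> in measure_pmf \<mu>. lambda_max (random_mat_sum n d Y \<xi>) \<ge> (1 + \<delta>) * lambda_max mean)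
      \<le> real d * exp (- (\<delta>\<^sup>2 * lambda_max mean / (400 * R * D\<^sup>2)))" (is ?upper)
proof -
  obtain \<xi> where \<mu>: "\<mu> = return_pmf \<xi>" using deterministic[OF ind D] .
  \<comment> \<open>The random sum is its own mean, so a deviation by a positive fraction of a
    positive eigenvalue has probability zero.\<close>
  have mean: "mean = random_mat_sum n d Y \<xi>"
    unfolding \<mu> mat_expectation_def
    by (rule eq_matI) (auto simp: random_mat_sum_def mat_sum_def)
  have nonneg: "lambda_min mean \<ge> 0" "lambda_max mean \<ge> 0"
    using lambda_nonneg[OF d symmetric_mean qf_mean_nonneg] by auto
  have trivial: "p \<le> real d * exp (- (\<delta>\<^sup>2 * m / (400 * R * D\<^sup>2)))"
    if "p \<le> 1" "\<delta> = 0 \<or> m = 0" for p m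
    using that d by auto
  show ?lower
  proof (cases "\<delta> = 0 \<or> lambda_min mean = 0")
    case False
    hence "\<delta> * lambda_min mean > 0" using nonneg \<delta> by (auto intro!: mult_pos_pos)
    hence "\<not> lambda_min (random_mat_sum n d Y \<xi>) \<le> (1 - \<delta>) * lambda_min mean"
      unfolding mean by (simp add: algebra_simps)
    thus ?thesis by (simp add: \<mu>)
  qed (intro trivial measure_pmf.prob_le_1)
  show ?upper
  proof (cases "\<delta> = 0 \<or> lambda_max mean = 0")
    case False
    hence "\<delta> * lambda_max mean > 0" using nonneg \<delta> by (auto intro!: mult_pos_pos)
    hence "\<not> lambda_max (random_mat_sum n d Y \<xi>) \<ge> (1 + \<delta>) * lambda_max mean"
      unfolding mean by (simp add: algebra_simps)
    thus ?thesis by (simp add: \<mu>)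
  qed (intro trivial measure_pmf.prob_le_1)
qed

lemma matrix_chernoff:
  assumes \<delta>: "\<delta> \<in> {0..1}"
  shows "\<P>(\<xi> in measure_pmf \<mu>. lambda_min (random_mat_sum n d Y \<xi>) \<le> (1 - \<delta>) * lambda_min mean)
      \<le> real d * exp (- (\<delta>\<^sup>2 * lambda_min mean / (400 * R * D\<^sup>2)))"
    and "\<P>(\<xi> in measure_pmf \<mu>. lambda_max (random_mat_sum n d Y \<xi>) \<ge> (1 + \<delta>) * lambda_max mean)
      \<le> real d * exp (- (\<delta>\<^sup>2 * lambda_max mean / (400 * R * D\<^sup>2)))"
  using lower_tail[OF _ \<delta>] upper_tail[OF _ \<delta>] deterministic_tail[OF _ \<delta>]
  by (meson not_le)+

end

end

theorem theorem1p2: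
  shows "\<exists>C::real. C > 0 \<and>
    (\<forall>(n::nat) (k::nat) (d::nat) (\<mu> :: (nat \<Rightarrow> real) pmf) (D::real) (R::real) (Y :: nat \<Rightarrow> real mat).
       d \<ge> 1 \<longrightarrow>
       distribution_on_cube n \<mu> \<longrightarrow>
       homogeneous n k \<mu> \<longrightarrow>
       linf_independent n \<mu> D \<longrightarrow>
       R > 0 \<longrightarrow>
       (\<forall>i\<in>{1..n}. symmetric_real_mat d (Y i) \<and>
          loewner_le d (0\<^sub>m d d) (Y i) \<and> loewner_le d (Y i) (R \<cdot>\<^sub>m 1\<^sub>m d)) \<longrightarrow>
       (let mu_min = lambda_min (mat_expectation d \<mu> (random_mat_sum n d Y));
            mu_max = lambda_max (mat_expectation d \<mu> (random_mat_sum n d Y))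
        in \<forall>\<delta>\<in>{0..1}.
          \<P>(\<xi> in measure_pmf \<mu>. lambda_min (random_mat_sum n d Y \<xi>) \<le> (1 - \<delta>) * mu_min)
            \<le> real d * exp (- (\<delta>\<^sup>2 * mu_min / (C * R * D\<^sup>2))) \<and>
          \<P>(\<xi> in measure_pmf \<mu>. lambda_max (random_mat_sum n d Y \<xi>) \<ge> (1 + \<delta>) * mu_max)
            \<le> real d * exp (- (\<delta>\<^sup>2 * mu_max / (C * R * D\<^sup>2)))))"
proof (rule exI[of _ 400], unfold Let_def, intro conjI allI impI ballI)
  fix n k d :: nat and \<mu> :: "(nat \<Rightarrow> real) pmf" and D R \<delta> :: real and Y :: "nat \<Rightarrow> real mat"
  assume "d \<ge> 1" "distribution_on_cube n \<mu>" "homogeneous n k \<mu>" "linf_independent n \<mu> D" "R > 0"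
    and "\<forall>i\<in>{1..n}. symmetric_real_mat d (Y i) \<and>
          loewner_le d (0\<^sub>m d d) (Y i) \<and> loewner_le d (Y i) (R \<cdot>\<^sub>m 1\<^sub>m d)"
    and "\<delta> \<in> {0..1}"
  note chernoff = matrix_chernoff[of n \<mu> k d D R Y \<delta>, OF this(2,3,1,4,5) _ _ _ this(7)]
  show "\<P>(\<xi> in measure_pmf \<mu>. lambda_min (random_mat_sum n d Y \<xi>)
      \<le> (1 - \<delta>) * lambda_min (mat_expectation d \<mu> (random_mat_sum n d Y)))
    \<le> real d * exp (- (\<delta>\<^sup>2 * lambda_min (mat_expectation d \<mu> (random_mat_sum n d Y)) / (400 * R * D\<^sup>2)))"
    using \<open>\<forall>i\<in>{1..n}. _\<close> by (intro chernoff(1)) auto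
  show "\<P>(\<xi> in measure_pmf \<mu>. lambda_max (random_mat_sum n d Y \<xi>)
      \<ge> (1 + \<delta>) * lambda_max (mat_expectation d \<mu> (random_mat_sum n d Y)))
    \<le> real d * exp (- (\<delta>\<^sup>2 * lambda_max (mat_expectation d \<mu> (random_mat_sum n d Y)) / (400 * R * D\<^sup>2)))"
    using \<open>\<forall>i\<in>{1..n}. _\<close> by (intro chernoff(2)) auto
qed simp

end
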